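(* Let $e_1,e_2,e_3$ and $e_4$ be eigenfunctions of $H=-\Delta+|x|^2$ on $\mathbb R^d$ with corresponding eigenvalues $\mu_1^2,\mu_2^2,\mu_3^2$ and $\mu_4^2$. Set $$L_0(e_1,e_2,e_3,e_4)=\int_{\mathbb R^d}e_1(x)e_2(x)e_3(x)e_4(x)\,dx.$$ Then, for any $k\in\mathbb N$, $$L_0=\frac{(-2)^k}{(\mu_1^2-\mu_2^2-\mu_3^2-\mu_4^2)^k}\,L_k.$$ Here $L_k$ is of the form $$L_k(e_1,e_2,e_3,e_4)=\int_{\mathbb R^d}e_1(x)\cdot\widetilde R_k(e_2,e_3,e_4)(x)\,dx,$$ where $\widetilde R_k(e_2,e_3,e_4)$ is a linear combination of terms of the form $$P(\alpha)e_2(x)\,P(\beta)e_3(x)\,P(\gamma)e_4(x),$$ with $P\in\{\nabla,x\}$, $\mathrm{Ord}(\alpha)+\mathrm{Ord}(\beta)+\mathrm{Ord}(\gamma)\le 2k$ and $0\le\mathrm{Ord}(\alpha),\mathrm{Ord}(\beta),\mathrm{Ord}(\gamma)\le k$.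
   Context: A multi-index of order $m$ is $\alpha=(\alpha_1,\dots,\alpha_m)$ with each $\alpha_j\in\{1,2\}$, and $\mathrm{Ord}(\alpha)=m$ is its length. The operators $P(\alpha)$, with $P\in\{\nabla,x\}$, are defined as follows. For order one and a scalar function $u$, $P(1)u=\nabla u$ and $P(2)u=xu$; for order one and a vector-valued function $\vec u:\mathbb R^d\to\mathbb R^d$, $P(1)\vec u=\mathrm{div}(\vec u)$ and $P(2)\vec u=x\cdot\vec u$. For order $m\ge2$, $P(\alpha)u=P(\alpha_1)P(\alpha_2)\cdots P(\alpha_m)u$ (composition). For example $P(1,1)u=\Delta u$, $P(2,1)u=x\cdot\nabla u$, $P(1,2)u=\mathrm{div}(xu)$, $P(2,2)u=|x|^2u$. For order $0$, $P(\alpha)$ is the identity. In the product of three factors, two vector-valued factors are multiplied by the scalar product, as in the term $\nabla e_2\cdot\nabla e_3\,e_4$ that occurs for $k=1$.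
   Formalization: For k≥2 and d≥2 the literal form of R_k is false; there the terms are products of ∇/x words with tensor-valued factors, all indices contracted in pairs (e.g. ∇²e_2:∇²e_3 e_4), same order bounds. For k≤1 or d=1 the literal P(α) terms are kept. The denominator is assumed nonzero. *)

theory Defs
  imports "HOL-Analysis.Analysis"
begin

section \<open>Differential operators on \<open>\<real>\<^sup>d\<close> and eigenfunctions of \<open>H\<close>\<close>

text \<open>Functions are real-valued: \<open>x u\<close> and \<open>\<nabla>u\<close> are to be \<open>\<real>\<^sup>d\<close>-valued.\<close>

definition partial :: "'n::finite \<Rightarrow> (real^'n \<Rightarrow> real) \<Rightarrow> real^'n \<Rightarrow> real" where
  "partial j u x = frechet_derivative u (at x) (axis j 1)"

definition gradient :: "(real^'n::finite \<Rightarrow> real) \<Rightarrow> real^'n \<Rightarrow> real^'n" where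
  "gradient u x = (\<chi> j. partial j u x)"

definition divergence :: "(real^'n::finite \<Rightarrow> real^'n) \<Rightarrow> real^'n \<Rightarrow> real" where
  "divergence V x = (\<Sum>j\<in>UNIV. partial j (\<lambda>y. V y $ j) x)"

definition laplacian :: "(real^'n::finite \<Rightarrow> real) \<Rightarrow> real^'n \<Rightarrow> real" where
  "laplacian u = divergence (gradient u)"

definition harmonic_oscillator :: "(real^'n::finite \<Rightarrow> real) \<Rightarrow> real^'n \<Rightarrow> real" where
  "harmonic_oscillator u x = - laplacian u x + (norm x)\<^sup>2 * u x"

text \<open>\<open>C\<^sup>\<infinity>\<close>: every iterated partial derivative exists and is (totally) differentiable.\<close>

definition smooth :: "(real^'n::finite \<Rightarrow> real) \<Rightarrow> bool" where
  "smooth u \<longleftrightarrow> (\<forall>js :: 'n list. \<forall>x. foldr partial js u differentiable (at x))"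

text \<open>
  Eigenfunctions of the self-adjoint operator \<open>H\<close> on \<open>L\<^sup>2(\<real>\<^sup>d)\<close>. By elliptic regularity
  every such \<open>L\<^sup>2\<close> class has a unique \<open>C\<^sup>\<infinity>\<close> representative, which is the function meant
  whenever pointwise derivatives are taken. No decay beyond \<open>L\<^sup>2\<close> is assumed.
\<close>

definition eigenfunction :: "(real^'n::finite \<Rightarrow> real) \<Rightarrow> real \<Rightarrow> bool" where
  "eigenfunction e lam \<longleftrightarrow>
     smooth e \<and> integrable lborel (\<lambda>x. (e x)\<^sup>2) \<and> (\<exists>x. e x \<noteq> 0) \<and>
     (\<forall>x. harmonic_oscillator e x = lam * e x)"

section \<open>The operators \<open>P(\<alpha>)\<close>\<close>

text \<open>The entries \<open>1\<close> and \<open>2\<close> of a multi-index are written \<open>Nabla\<close> and \<open>Pos\<close>.\<close>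

datatype letter = Nabla | Pos

datatype 'n quantity =
    Scal "real^'n \<Rightarrow> real"
  | Vec "real^'n \<Rightarrow> real^'n"

fun P1 :: "letter \<Rightarrow> 'n::finite quantity \<Rightarrow> 'n quantity" where
  "P1 Nabla (Scal u) = Vec (gradient u)"
| "P1 Pos   (Scal u) = Vec (\<lambda>x. u x *\<^sub>R x)"
| "P1 Nabla (Vec V)  = Scal (divergence V)"
| "P1 Pos   (Vec V)  = Scal (\<lambda>x. x \<bullet> V x)"

definition P :: "letter list \<Rightarrow> (real^'n::finite \<Rightarrow> real) \<Rightarrow> 'n quantity" where
  "P \<alpha> u = foldr P1 \<alpha> (Scal u)"

text \<open>With one or three vector-valued factors the product is not a scalar function; such
  products are excluded below by the parity of the total order.\<close>

fun product3 :: "'n::finite quantity \<Rightarrow> 'n quantity \<Rightarrow> 'n quantity \<Rightarrow> real^'n \<Rightarrow> real" where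
  "product3 (Scal f) (Scal g) (Scal h) x = f x * g x * h x"
| "product3 (Vec F)  (Vec G)  (Scal h) x = (F x \<bullet> G x) * h x"
| "product3 (Vec F)  (Scal g) (Vec H)  x = (F x \<bullet> H x) * g x"
| "product3 (Scal f) (Vec G)  (Vec H)  x = f x * (G x \<bullet> H x)"
| "product3 _ _ _ x = undefined"

type_synonym 'n trilinear =
  "(real^'n \<Rightarrow> real) \<Rightarrow> (real^'n \<Rightarrow> real) \<Rightarrow> (real^'n \<Rightarrow> real) \<Rightarrow> real^'n \<Rightarrow> real"

definition orders_ok :: "nat \<Rightarrow> 'a list \<times> 'a list \<times> 'a list \<Rightarrow> bool" where
  "orders_ok k = (\<lambda>(\<alpha>, \<beta>, \<gamma>).
     length \<alpha> + length \<beta> + length \<gamma> \<le> 2 * k \<and>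
     length \<alpha> \<le> k \<and> length \<beta> \<le> k \<and> length \<gamma> \<le> k)"

definition P_terms :: "nat \<Rightarrow> (letter list \<times> letter list \<times> letter list) set" where
  "P_terms k = {(\<alpha>, \<beta>, \<gamma>). orders_ok k (\<alpha>, \<beta>, \<gamma>) \<and>
     even (length \<alpha> + length \<beta> + length \<gamma>)}"

definition P_term :: "letter list \<times> letter list \<times> letter list \<Rightarrow> 'n::finite trilinear" where
  "P_term = (\<lambda>(\<alpha>, \<beta>, \<gamma>) u v w. product3 (P \<alpha> u) (P \<beta> v) (P \<gamma> w))"

section \<open>Terms with tensor-valued factors\<close>

text \<open>
  For \<open>d \<ge> 2\<close> and \<open>k \<ge> 2\<close> the terms \<open>P(\<alpha>)e\<^sub>2 P(\<beta>)e\<^sub>3 P(\<gamma>)e\<^sub>4\<close>, in which \<open>\<nabla>\<close> applied to a vector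
  field is its divergence, do not suffice. Expanding over all \<open>e\<^sub>1\<close> forces
  \<open>R\<^sub>2(e\<^sub>2, e\<^sub>3, e\<^sub>4) = (H - \<mu>\<^sub>2\<^sup>2 - \<mu>\<^sub>3\<^sup>2 - \<mu>\<^sub>4\<^sup>2)\<^sup>2 (e\<^sub>2 e\<^sub>3 e\<^sub>4) / 4\<close>, which contains
  \<open>\<nabla>\<^sup>2e\<^sub>2 : \<nabla>\<^sup>2e\<^sub>3 e\<^sub>4\<close>. For \<open>d = 2\<close>, \<open>e\<^sub>2 = e\<^sub>3 = x\<^sub>1 x\<^sub>2 exp (-|x|\<^sup>2/2)\<close>,
  \<open>e\<^sub>4 = exp (-|x|\<^sup>2/2)\<close> it equals \<open>2\<close> at the origin, where every \<open>P(\<alpha>)e\<^sub>2\<close> of order at most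
  \<open>2\<close> vanishes. The terms have to be understood with tensor-valued factors:
  each letter of \<open>\<alpha>, \<beta>, \<gamma>\<close> carries an index, every index occurs exactly twice in the product,
  and repeated indices are summed over the coordinates (the scalar product). On smooth functions
  the products of the previous section are those in which the indices within each factor
  are contracted consecutively from the right.
\<close>

fun comp1 :: "letter \<Rightarrow> 'n::finite \<Rightarrow> (real^'n \<Rightarrow> real) \<Rightarrow> real^'n \<Rightarrow> real" where
  "comp1 Nabla j u = partial j u"
| "comp1 Pos   j u = (\<lambda>x. x $ j * u x)"

text \<open>A tensor index is a natural number; \<open>\<iota>\<close> assigns a coordinate to each of them.\<close>

definition P_comp :: "(nat \<Rightarrow> 'n::finite) \<Rightarrow> (letter \<times> nat) list \<Rightarrow> (real^'n \<Rightarrow> real) \<Rightarrow> real^'n \<Rightarrow> real"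
  where "P_comp \<iota> \<alpha> u = foldr (\<lambda>(a, i). comp1 a (\<iota> i)) \<alpha> u"

definition indices :: "(letter \<times> nat) list \<times> (letter \<times> nat) list \<times> (letter \<times> nat) list \<Rightarrow> nat list" where
  "indices = (\<lambda>(\<alpha>, \<beta>, \<gamma>). map snd (\<alpha> @ \<beta> @ \<gamma>))"

definition tensor_terms ::
    "nat \<Rightarrow> ((letter \<times> nat) list \<times> (letter \<times> nat) list \<times> (letter \<times> nat) list) set" where
  "tensor_terms k = {t. orders_ok k t \<and> (\<forall>i\<in>set (indices t). count_list (indices t) i = 2)}"

definition tensor_term ::
    "(letter \<times> nat) list \<times> (letter \<times> nat) list \<times> (letter \<times> nat) list \<Rightarrow> 'n::finite trilinear" where
  "tensor_term = (\<lambda>(\<alpha>, \<beta>, \<gamma>) u v w x.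
     \<Sum>\<iota> \<in> set (indices (\<alpha>, \<beta>, \<gamma>)) \<rightarrow>\<^sub>E UNIV. P_comp \<iota> \<alpha> u x * P_comp \<iota> \<beta> v x * P_comp \<iota> \<gamma> w x)"

definition linear_combination :: "('t \<Rightarrow> 'n::finite trilinear) \<Rightarrow> 't set \<Rightarrow> 'n trilinear \<Rightarrow> bool" where
  "linear_combination term T R \<longleftrightarrow>
     (\<exists>S c. finite S \<and> S \<subseteq> T \<and> (\<forall>u v w x. R u v w x = (\<Sum>t\<in>S. c t * term t u v w x)))"

section \<open>The integrals\<close>

definition L0 :: "(real^'n::finite \<Rightarrow> real) \<Rightarrow> (real^'n \<Rightarrow> real) \<Rightarrow> (real^'n \<Rightarrow> real) \<Rightarrow> (real^'n \<Rightarrow> real) \<Rightarrow> real" where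
  "L0 e1 e2 e3 e4 = (\<integral>x. e1 x * e2 x * e3 x * e4 x \<partial>lborel)"

definition L :: "'n::finite trilinear \<Rightarrow>
    (real^'n \<Rightarrow> real) \<Rightarrow> (real^'n \<Rightarrow> real) \<Rightarrow> (real^'n \<Rightarrow> real) \<Rightarrow> (real^'n \<Rightarrow> real) \<Rightarrow> real" where
  "L R e1 e2 e3 e4 = (\<integral>x. e1 x * R e2 e3 e4 x \<partial>lborel)"

end

theory Submission
  imports Defs "HOL-Probability.Distributions"
begin

text \<open>
  The operator \<open>H = -\<Delta> + |x|\<^sup>2\<close> is symmetric, so \<open>\<mu>\<^sub>1\<^sup>2 \<integral> e\<^sub>1 T = \<integral> (H e\<^sub>1) T = \<integral> e\<^sub>1 H T\<close> for every
  function \<open>T\<close> that decays together with its derivatives. Let \<open>T\<close> be a contracted product of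
  \<open>P(\<alpha>)e\<^sub>2\<close>, \<open>P(\<beta>)e\<^sub>3\<close> and \<open>P(\<gamma>)e\<^sub>4\<close>. By \<open>[H, \<partial>\<^sub>j] = -2 x\<^sub>j\<close> and \<open>[H, x\<^sub>j] = -2 \<partial>\<^sub>j\<close>, applying
  \<open>H\<close> to a factor \<open>P(\<alpha>)e\<^sub>2\<close> gives \<open>\<mu>\<^sub>2\<^sup>2 P(\<alpha>)e\<^sub>2\<close> minus twice the words in which one letter of
  \<open>\<alpha>\<close> is exchanged for the other, of the same order. The failure of \<open>H\<close> to be a derivation adds
  \<open>-2\<close> times the scalar products of the gradients of two factors and \<open>-2 |x|\<^sup>2 T\<close>; each of these
  puts one new letter on two of the factors. Hence
  \<open>(\<mu>\<^sub>1\<^sup>2 - \<mu>\<^sub>2\<^sup>2 - \<mu>\<^sub>3\<^sup>2 - \<mu>\<^sub>4\<^sup>2) \<integral> e\<^sub>1 T = -2 \<integral> e\<^sub>1 T'\<close>, where \<open>T'\<close> is a sum of terms of total order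
  at most two higher, and of order at most one higher in each factor (\<open>L_tensor_term_step\<close>,
  \<open>successors_tensor_terms\<close>). Starting from \<open>T = e\<^sub>2 e\<^sub>3 e\<^sub>4\<close>, \<open>k\<close> such steps prove the formula.

  The analytic issue is that eigenfunctions are only known to be smooth and square integrable, while
  the integrations by parts need decay. This is supplied by \<open>eigenfunction_gauss\<close>: up to a
  factor \<open>exp (s |x|)\<close>, every derivative of an eigenfunction decays like the Gaussian. Indeed \<open>A\<^sub>j = \<partial>\<^sub>j + x\<^sub>j\<close> lowers the eigenvalue by \<open>2\<close>, and the energy
  identity \<open>\<Sum>\<^sub>j \<parallel>A\<^sub>j u\<parallel>\<^sup>2 = (\<lambda> - d) \<parallel>u\<parallel>\<^sup>2\<close>, proved as an inequality with cutoffs, shows that \<open>A\<^sub>j u\<close> is again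
  square integrable and that \<open>u = 0\<close> if \<open>\<lambda> < d\<close>. So all sufficiently long products of the \<open>A\<^sub>j\<close>
  annihilate an eigenfunction \<open>e\<close>. Since \<open>A\<^sub>j\<close> is \<open>\<partial>\<^sub>j\<close> conjugated by the Gaussian, the derivatives of
  high order of \<open>e exp (|x|\<^sup>2 / 2)\<close> vanish, and \<open>e\<close> is a polynomial times the Gaussian.

  The words \<open>\<alpha>, \<beta>, \<gamma>\<close> carry indices to be contracted. For \<open>k \<le> 1\<close> and in dimension one, forgetting
  the indices turns each term into the corresponding product of the \<open>P(\<alpha>)\<close> in the sense of gradients,
  divergences and scalar products.
\<close>

section \<open>Partial derivatives and smooth functions\<close>

lemma partial_eqI:
  assumes "(u has_derivative D) (at x)"
  shows "partial j u x = D (axis j 1)"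
  using frechet_derivative_at[OF assms] by (simp add: partial_def)

lemma partial_add:
  assumes "\<And>x. u differentiable at x" "\<And>x. v differentiable at x"
  shows "partial j (\<lambda>x. u x + v x) = (\<lambda>x. partial j u x + partial j v x)"
proof
  fix x
  have "((\<lambda>x. u x + v x) has_derivative
      (\<lambda>h. frechet_derivative u (at x) h + frechet_derivative v (at x) h)) (at x)"
    using assms by (intro has_derivative_add) (simp_all add: frechet_derivative_works[symmetric])
  from partial_eqI[OF this] show "partial j (\<lambda>x. u x + v x) x = partial j u x + partial j v x"
    by (simp add: partial_def)
qed

lemma partial_mult:
  assumes "\<And>x. u differentiable at x" "\<And>x. v differentiable at x"
  shows "partial j (\<lambda>x. u x * v x) = (\<lambda>x. partial j u x * v x + u x * partial j v x)"
proof
  fix x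
  have "((\<lambda>x. u x * v x) has_derivative
      (\<lambda>h. u x * frechet_derivative v (at x) h + frechet_derivative u (at x) h * v x)) (at x)"
    using assms by (intro has_derivative_mult) (simp_all add: frechet_derivative_works[symmetric])
  from partial_eqI[OF this]
  show "partial j (\<lambda>x. u x * v x) x = partial j u x * v x + u x * partial j v x"
    by (simp add: partial_def)
qed

lemma partial_const: "partial j (\<lambda>x. c) = (\<lambda>x. 0)"
  by (rule ext) (subst partial_eqI[OF has_derivative_const], simp)

lemma partial_coord: "partial j (\<lambda>x::real^'n::finite. x $ i) = (\<lambda>x. if i = j then 1 else 0)"
proof
  fix x :: "real^'n"
  have "((\<lambda>x. x $ i) has_derivative (\<lambda>h. h $ i)) (at x)"
    by (rule bounded_linear_imp_has_derivative) (rule bounded_linear_vec_nth)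
  from partial_eqI[OF this] show "partial j (\<lambda>x. x $ i) x = (if i = j then 1 else 0)"
    by (simp add: axis_def)
qed

lemma differentiable_coord: "(\<lambda>x::real^'n. x $ i) differentiable at x"
  by (rule bounded_linear_imp_differentiable) (rule bounded_linear_vec_nth)

lemma partial_cmult:
  assumes "\<And>x. u differentiable at x"
  shows "partial j (\<lambda>x. c * u x) = (\<lambda>x. c * partial j u x)"
  by (subst partial_mult) (simp_all add: assms partial_const)

lemma partial_coord_mult:
  assumes "\<And>x. u differentiable at x"
  shows "partial j (\<lambda>x. x $ i * u x) = (\<lambda>x. (if i = j then u x else 0) + x $ i * partial j u x)"
  by (subst partial_mult) (auto simp: assms partial_coord differentiable_coord)

lemma partial_sum:
  assumes "finite I" "\<And>i x. i \<in> I \<Longrightarrow> u i differentiable at x"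
  shows "partial j (\<lambda>x. \<Sum>i\<in>I. u i x) = (\<lambda>x. \<Sum>i\<in>I. partial j (u i) x)"
  using assms
proof (induction I)
  case (insert i I)
  have "(\<lambda>x. \<Sum>i\<in>I. u i x) differentiable at x" for x
    using insert by (intro differentiable_sum) auto
  then show ?case using insert by (simp add: partial_add)
qed (simp add: partial_const)

lemma has_real_derivative_along_axis:
  assumes "u differentiable at (x + t *\<^sub>R axis j 1)"
  shows "((\<lambda>t. u (x + t *\<^sub>R axis j 1)) has_real_derivative partial j u (x + t *\<^sub>R axis j 1)) (at t)"
proof -
  define D where "D = frechet_derivative u (at (x + t *\<^sub>R axis j 1))"
  have D: "(u has_derivative D) (at (x + t *\<^sub>R axis j 1))"
    using assms unfolding D_def by (simp add: frechet_derivative_works[symmetric])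
  have "((\<lambda>t. u (x + t *\<^sub>R axis j 1)) has_derivative (\<lambda>h. D (h *\<^sub>R axis j 1))) (at t)"
    by (rule has_derivative_compose[where g = u and f = "\<lambda>t. x + t *\<^sub>R axis j 1"])
      (auto intro!: derivative_eq_intros D)
  moreover have "D (h *\<^sub>R axis j 1) = partial j u (x + t *\<^sub>R axis j 1) * h" for h
    using linear_scale[OF has_derivative_linear[OF D]] by (simp add: partial_def D_def)
  ultimately show ?thesis
    by (simp add: has_field_derivative_def)
qed

lemma continuous_differentiable: 
  assumes "\<And>x::real^'n. u differentiable at x"
  shows "continuous_on S u"
  using assms by (simp add: continuous_at_imp_continuous_on differentiable_imp_continuous_within)

text \<open>Apply the mean value theorem in direction \<open>i\<close>, then in direction \<open>j\<close>.\<close>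

lemma second_difference_mean_value:
  fixes u :: "real^'n::finite \<Rightarrow> real"
  assumes u: "\<And>x. u differentiable at x" and du: "\<And>x. partial i u differentiable at x"
    and h: "h > 0"
  shows "\<exists>y. dist y x \<le> 2 * h \<and> u (x + h *\<^sub>R axis i 1 + h *\<^sub>R axis j 1) - u (x + h *\<^sub>R axis i 1)
     - u (x + h *\<^sub>R axis j 1) + u x = h * h * partial j (partial i u) y"
proof -
  define \<phi> where "\<phi> s = u ((x + h *\<^sub>R axis j 1) + s *\<^sub>R axis i 1) - u (x + s *\<^sub>R axis i 1)" for s
  have "(\<phi> has_real_derivative (partial i u ((x + h *\<^sub>R axis j 1) + s *\<^sub>R axis i 1)
      - partial i u (x + s *\<^sub>R axis i 1))) (at s)" for s
    unfolding \<phi>_def by (intro DERIV_diff has_real_derivative_along_axis u)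
  from MVT2[OF h this] obtain s where s: "0 < s" "s < h"
    "\<phi> h - \<phi> 0 = h * (partial i u ((x + h *\<^sub>R axis j 1) + s *\<^sub>R axis i 1)
      - partial i u (x + s *\<^sub>R axis i 1))" by auto
  have "((\<lambda>t. partial i u ((x + s *\<^sub>R axis i 1) + t *\<^sub>R axis j 1)) has_real_derivative
      partial j (partial i u) ((x + s *\<^sub>R axis i 1) + t *\<^sub>R axis j 1)) (at t)" for t
    by (intro has_real_derivative_along_axis du)
  from MVT2[OF h this] obtain t where t: "0 < t" "t < h"
    "partial i u ((x + s *\<^sub>R axis i 1) + h *\<^sub>R axis j 1) - partial i u (x + s *\<^sub>R axis i 1)
      = h * partial j (partial i u) ((x + s *\<^sub>R axis i 1) + t *\<^sub>R axis j 1)" by auto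
  let ?y = "(x + s *\<^sub>R axis i 1) + t *\<^sub>R axis j (1::real)"
  have "dist ?y x = norm (s *\<^sub>R axis i 1 + t *\<^sub>R axis j (1::real))"
    by (simp add: dist_norm)
  also have "\<dots> \<le> norm (s *\<^sub>R axis i (1::real)) + norm (t *\<^sub>R axis j (1::real))"
    by (rule norm_triangle_ineq)
  also have "\<dots> \<le> 2 * h" using s t by simp
  finally have "dist ?y x \<le> 2 * h" .
  moreover have "u (x + h *\<^sub>R axis i 1 + h *\<^sub>R axis j 1) - u (x + h *\<^sub>R axis i 1)
     - u (x + h *\<^sub>R axis j 1) + u x = \<phi> h - \<phi> 0"
    by (simp add: \<phi>_def add.assoc add.commute[of "h *\<^sub>R axis i 1"])
  moreover have "\<phi> h - \<phi> 0 = h * h * partial j (partial i u) ?y"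
  proof -
    have "x + h *\<^sub>R axis j 1 + s *\<^sub>R axis i 1 = x + s *\<^sub>R axis i 1 + h *\<^sub>R axis j (1::real)"
      by (simp add: add.assoc add.commute[of "h *\<^sub>R axis j 1"])
    with s(3) t(3) show ?thesis by (simp only: mult.assoc)
  qed
  ultimately show ?thesis by (intro exI[of _ ?y]) simp
qed

text \<open>
  The second difference over a small square is symmetric in \<open>i\<close> and \<open>j\<close>, so the two mixed
  derivatives take equal values at points arbitrarily close to \<open>x\<close>; pass to the limit by continuity.
\<close>

lemma partial_commute:
  fixes u :: "real^'n::finite \<Rightarrow> real"
  assumes u: "\<And>x. u differentiable at x" and du: "\<And>k x. partial k u differentiable at x"
    and ddu: "\<And>k l. continuous_on UNIV (partial k (partial l u))"
  shows "partial i (partial j u) = partial j (partial i u)"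
proof
  fix x
  have conv: "(\<lambda>n. partial k (partial l u) (y n)) \<longlonglongrightarrow> partial k (partial l u) x"
    if "\<And>n. dist (y n) x \<le> 2 * (1 / real (Suc n))" for y k l
  proof -
    have "(\<lambda>n. 2 * (1 / real (Suc n))) \<longlonglongrightarrow> 2 * 0"
      by (intro tendsto_mult tendsto_const LIMSEQ_Suc[OF lim_1_over_n])
    then have "(\<lambda>n. 2 * (1 / real (Suc n))) \<longlonglongrightarrow> 0" by simp
    moreover have "\<forall>\<^sub>F n in sequentially. norm (dist (y n) x) \<le> 2 * (1 / real (Suc n))"
      using that by (simp only: real_norm_def abs_of_nonneg zero_le_dist eventually_sequentially) blast
    ultimately have "(\<lambda>n. dist (y n) x) \<longlonglongrightarrow> 0"
      by (rule Lim_null_comparison[rotated])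
    then have "y \<longlonglongrightarrow> x" by (simp add: tendsto_dist_iff[of y])
    from continuous_on_tendsto_compose[OF ddu[of k l] this] show ?thesis by simp
  qed
  define d where "d n = u (x + (1 / real (Suc n)) *\<^sub>R axis i 1 + (1 / real (Suc n)) *\<^sub>R axis j 1)
     - u (x + (1 / real (Suc n)) *\<^sub>R axis i 1) - u (x + (1 / real (Suc n)) *\<^sub>R axis j 1) + u x" for n
  have "\<exists>y. dist y x \<le> 2 * (1 / real (Suc n)) \<and>
      d n = (1 / real (Suc n)) * (1 / real (Suc n)) * partial j (partial i u) y" for n
    unfolding d_def by (rule second_difference_mean_value[OF u du]) simp
  then obtain y where y: "\<And>n. dist (y n) x \<le> 2 * (1 / real (Suc n))"
     "\<And>n. d n = (1 / real (Suc n)) * (1 / real (Suc n)) * partial j (partial i u) (y n)" by metis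
  have "\<exists>z. dist z x \<le> 2 * (1 / real (Suc n)) \<and>
      d n = (1 / real (Suc n)) * (1 / real (Suc n)) * partial i (partial j u) z" for n
  proof -
    define h where "h = 1 / real (Suc n)"
    have "h > 0" by (simp add: h_def)
    then obtain z where z: "dist z x \<le> 2 * h"
      "u (x + h *\<^sub>R axis j 1 + h *\<^sub>R axis i 1) - u (x + h *\<^sub>R axis j 1)
       - u (x + h *\<^sub>R axis i 1) + u x = h * h * partial i (partial j u) z"
      using second_difference_mean_value[OF u du] by blast
    have swap: "x + h *\<^sub>R axis i 1 + h *\<^sub>R axis j 1 = x + h *\<^sub>R axis j 1 + h *\<^sub>R axis i 1"
      by (simp add: ac_simps)
    have "d n = h * h * partial i (partial j u) z"
      using z(2) unfolding d_def h_def[symmetric] swap by linarith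
    with z(1) show ?thesis unfolding h_def by blast
  qed
  then obtain z where z: "\<And>n. dist (z n) x \<le> 2 * (1 / real (Suc n))"
     "\<And>n. d n = (1 / real (Suc n)) * (1 / real (Suc n)) * partial i (partial j u) (z n)" by metis
  have "partial i (partial j u) (z n) = partial j (partial i u) (y n)" for n
    using y(2)[of n] z(2)[of n] by simp
  then show "partial i (partial j u) x = partial j (partial i u) x"
    using conv[OF z(1), of i j] conv[OF y(1), of j i] by (simp add: LIMSEQ_unique)
qed

text \<open>
  One notion serves for smoothness (\<open>B\<close> always true) and for decay of all derivatives (\<open>B\<close> a
  growth bound). It is the largest class of differentiable functions satisfying \<open>B\<close> that is closed
  under partial derivatives, hence the coinduction rule below, which spares computing iterated
  derivatives of sums and products.
\<close>

definition smooth_with :: "((real^'n::finite \<Rightarrow> real) \<Rightarrow> bool) \<Rightarrow> (real^'n \<Rightarrow> real) \<Rightarrow> bool" where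
  "smooth_with B u \<longleftrightarrow>
     (\<forall>js. (\<forall>x. foldr partial js u differentiable (at x)) \<and> B (foldr partial js u))"

lemma smooth_iff: "smooth u \<longleftrightarrow> smooth_with (\<lambda>_. True) u"
  by (simp add: smooth_def smooth_with_def)

lemma smooth_with_smooth: "smooth_with B u \<Longrightarrow> smooth u"
  by (simp add: smooth_def smooth_with_def)

lemma smooth_with_coinduct:
  assumes "X u"
    and step: "\<And>u. X u \<Longrightarrow> (\<forall>x. u differentiable at x) \<and> B u \<and> (\<forall>j. X (partial j u))"
  shows "smooth_with B u"
proof -
  have "X (foldr partial js u)" for js
  proof (induction js)
    case Nil
    then show ?case using \<open>X u\<close> by simp
  next
    case (Cons j js)
    then have "\<forall>j. X (partial j (foldr partial js u))" using step by blast
    then show ?case by simp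
  qed
  with step show ?thesis unfolding smooth_with_def by blast
qed

lemma smooth_with_differentiable: "smooth_with B u \<Longrightarrow> u differentiable at x"
  unfolding smooth_with_def by (elim allE[of _ "[]"]) simp

lemma smooth_with_bound: "smooth_with B u \<Longrightarrow> B u"
  unfolding smooth_with_def by (elim allE[of _ "[]"]) simp

lemma smooth_with_partial: "smooth_with B u \<Longrightarrow> smooth_with B (partial j u)"
  unfolding smooth_with_def
proof
  fix js assume "\<forall>js. (\<forall>x. foldr partial js u differentiable at x) \<and> B (foldr partial js u)"
  from this[rule_format, of "js @ [j]"]
  show "(\<forall>x. foldr partial js (partial j u) differentiable at x) \<and> B (foldr partial js (partial j u))"
    by simp
qed

lemma smooth_with_partialI:
  assumes "\<And>x. u differentiable at x" "B u" "\<And>j. smooth_with B (partial j u)"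
  shows "smooth_with B u"
  unfolding smooth_with_def
proof
  fix js
  show "(\<forall>x. foldr partial js u differentiable at x) \<and> B (foldr partial js u)"
    using assms by (cases js rule: rev_cases) (auto simp: smooth_with_def)
qed

lemma smooth_with_commute:
  assumes "smooth_with B u"
  shows "partial i (partial j u) = partial j (partial i u)"
proof (rule partial_commute)
  note D = smooth_with_differentiable[of B]
  show "u differentiable at x" for x by (rule D[OF assms])
  show "partial k u differentiable at x" for k x by (rule D[OF smooth_with_partial[OF assms]])
  show "continuous_on UNIV (partial k (partial l u))" for k l
    by (rule continuous_differentiable, rule D[OF smooth_with_partial[OF smooth_with_partial[OF assms]]])
qed

lemma smooth_with_add:
  assumes "smooth_with B u" "smooth_with B v"
    and B: "\<And>u v. B u \<Longrightarrow> B v \<Longrightarrow> B (\<lambda>x. u x + v x)"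
  shows "smooth_with B (\<lambda>x. u x + v x)"
proof (rule smooth_with_coinduct[where
      X = "\<lambda>w. \<exists>u v. w = (\<lambda>x. u x + v x) \<and> smooth_with B u \<and> smooth_with B v"])
  show "\<exists>u' v'. (\<lambda>x. u x + v x) = (\<lambda>x. u' x + v' x) \<and> smooth_with B u' \<and> smooth_with B v'"
    using assms by blast
next
  fix w assume "\<exists>u v. w = (\<lambda>x. u x + v x) \<and> smooth_with B u \<and> smooth_with B v"
  then obtain u v where w: "w = (\<lambda>x. u x + v x)" and uv: "smooth_with B u" "smooth_with B v" by blast
  note d = uv[THEN smooth_with_differentiable]
  have "partial j w = (\<lambda>x. partial j u x + partial j v x)" for j
    unfolding w by (rule partial_add[OF d])
  then have "\<exists>u v. partial j w = (\<lambda>x. u x + v x) \<and> smooth_with B u \<and> smooth_with B v" for j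
    using uv[THEN smooth_with_partial] by blast
  moreover have "w differentiable at x" for x
    unfolding w by (intro differentiable_add d)
  moreover have "B w"
    unfolding w by (rule B[OF uv[THEN smooth_with_bound]])
  ultimately show "(\<forall>x. w differentiable at x) \<and> B w \<and>
      (\<forall>j. \<exists>u v. partial j w = (\<lambda>x. u x + v x) \<and> smooth_with B u \<and> smooth_with B v)"
    by blast
qed

text \<open>By the product rule this class, unlike that of single products, is closed under \<open>partial\<close>.\<close>

inductive sum_of_products for B1 B2 where
  product: "smooth_with B1 u \<Longrightarrow> smooth_with B2 v \<Longrightarrow> sum_of_products B1 B2 (\<lambda>x. u x * v x)"
| sum: "sum_of_products B1 B2 u \<Longrightarrow> sum_of_products B1 B2 v \<Longrightarrow> sum_of_products B1 B2 (\<lambda>x. u x + v x)"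

lemma smooth_with_mult:
  assumes "smooth_with B1 u" "smooth_with B2 v"
    and add: "\<And>u v. B u \<Longrightarrow> B v \<Longrightarrow> B (\<lambda>x. u x + v x)"
    and mult: "\<And>u v. B1 u \<Longrightarrow> B2 v \<Longrightarrow> B (\<lambda>x. u x * v x)"
  shows "smooth_with B (\<lambda>x. u x * v x)"
proof (rule smooth_with_coinduct[where X = "sum_of_products B1 B2"])
  show "sum_of_products B1 B2 (\<lambda>x. u x * v x)" using assms by (auto intro: sum_of_products.intros)
next
  fix w assume "sum_of_products B1 B2 w"
  then show "(\<forall>x. w differentiable at x) \<and> B w \<and> (\<forall>j. sum_of_products B1 B2 (partial j w))"
  proof induction
    case (product u v)
    note d = product[THEN smooth_with_differentiable]
    have "sum_of_products B1 B2 (partial j (\<lambda>x. u x * v x))" for j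
      unfolding partial_mult[OF d]
      by (intro sum_of_products.sum sum_of_products.product product[THEN smooth_with_partial] product)
    moreover have "(\<lambda>x. u x * v x) differentiable at x" for x
      by (intro differentiable_mult d)
    ultimately show ?case
      using mult[OF product[THEN smooth_with_bound]] by blast
  next
    case (sum u v)
    then have d: "\<And>x. u differentiable at x" "\<And>x. v differentiable at x" by blast+
    have "sum_of_products B1 B2 (partial j (\<lambda>x. u x + v x))" for j
      unfolding partial_add[OF d] using sum.IH by (intro sum_of_products.sum) blast+
    moreover have "(\<lambda>x. u x + v x) differentiable at x" for x
      by (intro differentiable_add d)
    ultimately show ?case
      using sum.IH add by blast
  qed
qed

lemma smooth_with_const:
  assumes "\<And>c. B (\<lambda>_. c)"
  shows "smooth_with B (\<lambda>_. c)"
  by (rule smooth_with_coinduct[where X = "\<lambda>u. \<exists>c. u = (\<lambda>_. c)"])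
    (use assms in \<open>auto simp: partial_const\<close>)

section \<open>Functions of Gaussian decay\<close>

text \<open>
  The factor \<open>exp (s |x|)\<close> dominates every polynomial, and the exponents add under multiplication;
  for \<open>c = 0\<close> polynomials satisfy the bound.
\<close>

definition gaussian_growth :: "real \<Rightarrow> (real^'n::finite \<Rightarrow> real) \<Rightarrow> bool" where
  "gaussian_growth c u \<longleftrightarrow> (\<exists>C s. \<forall>x. \<bar>u x\<bar> \<le> C * exp (s * norm x - c / 2 * (norm x)\<^sup>2))"

abbreviation gauss :: "real \<Rightarrow> (real^'n::finite \<Rightarrow> real) \<Rightarrow> bool" where
  "gauss c \<equiv> smooth_with (gaussian_growth c)"

lemma gaussian_growthI:
  "(\<And>x. \<bar>u x\<bar> \<le> C * exp (s * norm x - c / 2 * (norm x)\<^sup>2)) \<Longrightarrow> gaussian_growth c u"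
  unfolding gaussian_growth_def by blast

lemma gaussian_growth_add:
  fixes u v :: "real^'n::finite \<Rightarrow> real"
  assumes "gaussian_growth c u" "gaussian_growth c v"
  shows "gaussian_growth c (\<lambda>x. u x + v x)"
proof -
  obtain C s where u: "\<And>x. \<bar>u x\<bar> \<le> C * exp (s * norm x - c / 2 * (norm x)\<^sup>2)"
    using assms(1) unfolding gaussian_growth_def by blast
  obtain D t where v: "\<And>x. \<bar>v x\<bar> \<le> D * exp (t * norm x - c / 2 * (norm x)\<^sup>2)"
    using assms(2) unfolding gaussian_growth_def by blast
  have "C \<ge> 0" using order_trans[OF abs_ge_zero u[of 0]] by simp
  have "D \<ge> 0" using order_trans[OF abs_ge_zero v[of 0]] by simp
  show ?thesis
  proof (rule gaussian_growthI)
    fix x :: "real^'n"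
    have "exp (s * norm x - c / 2 * (norm x)\<^sup>2) \<le> exp (max s t * norm x - c / 2 * (norm x)\<^sup>2)"
      by (simp add: mult_right_mono)
    from mult_left_mono[OF this \<open>C \<ge> 0\<close>]
    have "\<bar>u x\<bar> \<le> C * exp (max s t * norm x - c / 2 * (norm x)\<^sup>2)" using u[of x] by linarith
    moreover have "exp (t * norm x - c / 2 * (norm x)\<^sup>2) \<le> exp (max s t * norm x - c / 2 * (norm x)\<^sup>2)"
      by (simp add: mult_right_mono)
    from mult_left_mono[OF this \<open>D \<ge> 0\<close>]
    have "\<bar>v x\<bar> \<le> D * exp (max s t * norm x - c / 2 * (norm x)\<^sup>2)" using v[of x] by linarith
    ultimately show "\<bar>u x + v x\<bar> \<le> (C + D) * exp (max s t * norm x - c / 2 * (norm x)\<^sup>2)"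
      using abs_triangle_ineq[of "u x" "v x"] by (simp add: distrib_right)
  qed
qed

lemma gaussian_growth_mult:
  fixes u v :: "real^'n::finite \<Rightarrow> real"
  assumes "gaussian_growth a u" "gaussian_growth b v"
  shows "gaussian_growth (a + b) (\<lambda>x. u x * v x)"
proof -
  obtain C s where u: "\<And>x. \<bar>u x\<bar> \<le> C * exp (s * norm x - a / 2 * (norm x)\<^sup>2)"
    using assms(1) unfolding gaussian_growth_def by blast
  obtain D t where v: "\<And>x. \<bar>v x\<bar> \<le> D * exp (t * norm x - b / 2 * (norm x)\<^sup>2)"
    using assms(2) unfolding gaussian_growth_def by blast
  show ?thesis
  proof (rule gaussian_growthI)
    fix x :: "real^'n"
    have "\<bar>u x * v x\<bar> \<le> (C * exp (s * norm x - a / 2 * (norm x)\<^sup>2)) * (D * exp (t * norm x - b / 2 * (norm x)\<^sup>2))"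
      unfolding abs_mult using order_trans[OF abs_ge_zero u[of x]] by (intro mult_mono u v) auto
    also have "\<dots> = (C * D) * (exp (s * norm x - a / 2 * (norm x)\<^sup>2) * exp (t * norm x - b / 2 * (norm x)\<^sup>2))"
      by (simp only: mult_ac)
    also have "\<dots> = (C * D) * exp ((s + t) * norm x - (a + b) / 2 * (norm x)\<^sup>2)"
      by (simp only: exp_add[symmetric]) (simp add: algebra_simps add_divide_distrib)
    finally show "\<bar>u x * v x\<bar> \<le> (C * D) * exp ((s + t) * norm x - (a + b) / 2 * (norm x)\<^sup>2)" .
  qed
qed

lemma gauss_add: "gauss c u \<Longrightarrow> gauss c v \<Longrightarrow> gauss c (\<lambda>x. u x + v x)"
  by (erule (1) smooth_with_add) (rule gaussian_growth_add)

lemma gauss_mult: "gauss a u \<Longrightarrow> gauss b v \<Longrightarrow> gauss (a + b) (\<lambda>x. u x * v x)"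
  by (erule (1) smooth_with_mult) (erule (1) gaussian_growth_add gaussian_growth_mult)+

lemma gauss_const: "gauss 0 (\<lambda>_. c)"
proof (rule smooth_with_const)
  show "gaussian_growth 0 (\<lambda>_. c)" for c
    by (rule gaussian_growthI[of _ "\<bar>c\<bar>" 0]) simp
qed

lemma gauss_coord: "gauss 0 (\<lambda>x::real^'n::finite. x $ i)"
proof (rule smooth_with_partialI)
  show "(\<lambda>x::real^'n. x $ i) differentiable at x" for x
    by (rule differentiable_coord)
  show "gaussian_growth 0 (\<lambda>x::real^'n. x $ i)"
  proof (rule gaussian_growthI)
    fix x :: "real^'n"
    have "\<bar>x $ i\<bar> \<le> exp (norm x)"
      using component_le_norm_cart[of x i] exp_ge_add_one_self[of "norm x"] by linarith
    then show "\<bar>x $ i\<bar> \<le> 1 * exp (1 * norm x - 0 / 2 * (norm x)\<^sup>2)" by simp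
  qed
  show "gauss 0 (partial j (\<lambda>x::real^'n. x $ i))" for j
    unfolding partial_coord by (rule gauss_const)
qed

lemma gauss_cmult: "gauss c u \<Longrightarrow> gauss c (\<lambda>x. a * u x)"
  using gauss_mult[OF gauss_const] by simp

lemma gauss_diff: "gauss c u \<Longrightarrow> gauss c v \<Longrightarrow> gauss c (\<lambda>x. u x - v x)"
  using gauss_add[of c u, OF _ gauss_cmult[of c v "-1"]] by simp

lemma gauss_coord_mult: "gauss c u \<Longrightarrow> gauss c (\<lambda>x. x $ i * u x)"
  using gauss_mult[OF gauss_coord] by simp

lemma partial_gaussian:
  "partial j (\<lambda>x::real^'n::finite. exp (- c / 2 * (norm x)\<^sup>2)) = (\<lambda>x. - c * x $ j * exp (- c / 2 * (norm x)\<^sup>2))"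
proof
  fix x :: "real^'n"
  have "((\<lambda>x::real^'n. exp (- c / 2 * (x \<bullet> x))) has_derivative
      (\<lambda>h. exp (- c / 2 * (x \<bullet> x)) * (- c / 2 * (x \<bullet> h + h \<bullet> x)))) (at x)"
    by (auto intro!: derivative_eq_intros)
  from partial_eqI[OF this]
  show "partial j (\<lambda>x::real^'n. exp (- c / 2 * (norm x)\<^sup>2)) x = - c * x $ j * exp (- c / 2 * (norm x)\<^sup>2)"
    by (simp add: power2_norm_eq_inner inner_axis inner_axis' inner_commute)
qed

lemma differentiable_gaussian: "(\<lambda>x::real^'n::finite. exp (- c / 2 * (norm x)\<^sup>2)) differentiable at x"
proof -
  have "((\<lambda>x::real^'n. exp (- c / 2 * (x \<bullet> x))) has_derivative
      (\<lambda>h. exp (- c / 2 * (x \<bullet> x)) * (- c / 2 * (x \<bullet> h + h \<bullet> x)))) (at x)"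
    by (auto intro!: derivative_eq_intros)
  then show ?thesis by (auto simp: power2_norm_eq_inner differentiable_def)
qed

text \<open>All derivatives of the Gaussian are products of it with a factor of class \<open>gauss 0\<close>.\<close>

lemma gauss_gaussian: "gauss c (\<lambda>x::real^'n::finite. exp (- c / 2 * (norm x)\<^sup>2))" (is "gauss c ?g")
proof (rule smooth_with_coinduct[where X = "\<lambda>u. \<exists>q. gauss 0 q \<and> u = (\<lambda>x. q x * ?g x)"])
  show "\<exists>q. gauss 0 q \<and> ?g = (\<lambda>x. q x * ?g x)"
    using gauss_const[of 1] by (intro exI[of _ "\<lambda>_. 1"]) simp
next
  fix u :: "real^'n \<Rightarrow> real"
  assume "\<exists>q. gauss 0 q \<and> u = (\<lambda>x. q x * ?g x)"
  then obtain q where q: "gauss 0 q" and u: "u = (\<lambda>x. q x * ?g x)" by blast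
  note dq = smooth_with_differentiable[OF q]
  have g: "gaussian_growth c ?g"
    by (rule gaussian_growthI[of _ 1 0]) simp
  have "gaussian_growth c u"
    using gaussian_growth_mult[OF smooth_with_bound[OF q] g] u by simp
  moreover have "u differentiable at x" for x
    unfolding u by (intro differentiable_mult dq differentiable_gaussian)
  moreover have "\<exists>q. gauss 0 q \<and> partial j u = (\<lambda>x. q x * ?g x)" for j
  proof (intro exI conjI)
    show "gauss 0 (\<lambda>x. partial j q x - c * (x $ j * q x))"
      by (intro gauss_diff gauss_cmult gauss_coord_mult smooth_with_partial q)
    show "partial j u = (\<lambda>x. (partial j q x - c * (x $ j * q x)) * ?g x)"
      unfolding u by (subst partial_mult[OF dq differentiable_gaussian])
        (simp only: partial_gaussian, simp add: algebra_simps)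
  qed
  ultimately show "(\<forall>x. u differentiable at x) \<and> gaussian_growth c u \<and>
      (\<forall>j. \<exists>q. gauss 0 q \<and> partial j u = (\<lambda>x. q x * ?g x))"
    by blast
qed

lemma gauss_sum:
  "(\<And>i. i \<in> I \<Longrightarrow> gauss c (u i)) \<Longrightarrow> gauss c (\<lambda>x. \<Sum>i\<in>I. u i x)"
proof -
  have 0: "gauss c (\<lambda>_. 0)" using gauss_cmult[OF gauss_gaussian, of c 0] by simp
  assume "\<And>i. i \<in> I \<Longrightarrow> gauss c (u i)"
  then show ?thesis
    by (induction I rule: infinite_finite_induct) (simp_all add: 0 gauss_add)
qed

lemma integrable_gaussian:
  assumes "a > 0"
  shows "integrable lborel (\<lambda>x::real^'n::finite. exp (- a * (norm x)\<^sup>2))"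
proof (rule integrableI_nonneg)
  define \<sigma> where "\<sigma> = 1 / sqrt (2 * a)"
  have \<sigma>: "\<sigma> > 0" "\<sigma>\<^sup>2 = 1 / (2 * a)" using assms by (simp_all add: \<sigma>_def power_divide)
  have eq: "exp (- a * t\<^sup>2) = sqrt (2 * pi * \<sigma>\<^sup>2) * normal_density 0 \<sigma> t" for t
    using \<sigma> assms by (simp add: normal_density_def field_simps)
  have "integrable lborel (\<lambda>t. exp (- a * t\<^sup>2))"
    unfolding eq using integrable_normal_density[OF \<sigma>(1)] by (intro integrable_mult_right) simp
  then have fin: "(\<integral>\<^sup>+ t. ennreal (exp (- a * t\<^sup>2)) \<partial>lborel) < \<infinity>"
    by (simp add: integrable_iff_bounded)
  have "exp (- a * (norm x)\<^sup>2) = (\<Prod>b\<in>Basis. exp (- a * (x \<bullet> b)\<^sup>2))" for x :: "real^'n"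
  proof -
    have "(norm x)\<^sup>2 = (\<Sum>b\<in>Basis. (x \<bullet> b)\<^sup>2)"
      unfolding power2_norm_eq_inner euclidean_inner[of x x] by (simp add: power2_eq_square)
    then show ?thesis by (simp add: exp_sum[symmetric] sum_distrib_left)
  qed
  then have "(\<integral>\<^sup>+ x. ennreal (exp (- a * (norm x)\<^sup>2)) \<partial>(lborel :: (real^'n) measure))
      = (\<integral>\<^sup>+ x. (\<Prod>b\<in>Basis. ennreal (exp (- a * (x \<bullet> b)\<^sup>2))) \<partial>(lborel :: (real^'n) measure))"
    by (simp add: prod_ennreal)
  also have "\<dots> = (\<Prod>b\<in>(Basis :: (real^'n) set). \<integral>\<^sup>+ t. ennreal (exp (- a * t\<^sup>2)) \<partial>lborel)"
    by (rule nn_integral_lborel_prod) auto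
  also have "\<dots> < \<infinity>" using fin by (simp add: power_less_top_ennreal)
  finally show "(\<integral>\<^sup>+ x. ennreal (exp (- a * (norm x)\<^sup>2)) \<partial>(lborel :: (real^'n) measure)) < \<infinity>" .
qed auto

lemma gauss_integrable:
  fixes u :: "real^'n::finite \<Rightarrow> real"
  assumes u: "gauss c u" and c: "c > 0"
  shows "integrable lborel u"
proof -
  obtain C s where b: "\<And>x. \<bar>u x\<bar> \<le> C * exp (s * norm x - c / 2 * (norm x)\<^sup>2)"
    using smooth_with_bound[OF u] unfolding gaussian_growth_def by blast
  have C: "C \<ge> 0" using order_trans[OF abs_ge_zero b[of 0]] by simp
  have "continuous_on UNIV u"
    by (rule continuous_differentiable) (rule smooth_with_differentiable[OF u])
  then have m: "u \<in> borel_measurable lborel"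
    by (simp add: borel_measurable_continuous_onI)
  (* completing the square: s r - c r^2/2 \<le> s^2/c - c r^2/4 *)
  have e: "s * r - c / 2 * r\<^sup>2 \<le> s\<^sup>2 / c - c / 4 * r\<^sup>2" for r :: real
  proof -
    have "s\<^sup>2 / c - c / 4 * r\<^sup>2 - (s * r - c / 2 * r\<^sup>2) = (s - c * r / 2)\<^sup>2 / c"
      using c by (simp add: field_simps power2_eq_square)
    moreover have "(s - c * r / 2)\<^sup>2 / c \<ge> 0" using c by simp
    ultimately show ?thesis by linarith
  qed
  have "norm (u x) \<le> norm (C * exp (s\<^sup>2 / c) * exp (- (c / 4) * (norm x)\<^sup>2))" for x
  proof -
    have "\<bar>u x\<bar> \<le> C * exp (s\<^sup>2 / c - c / 4 * (norm x)\<^sup>2)"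
      using mult_left_mono[OF e[of "norm x", THEN exp_le_cancel_iff[THEN iffD2]] C] b[of x] by linarith
    also have "\<dots> = C * exp (s\<^sup>2 / c) * exp (- (c / 4) * (norm x)\<^sup>2)"
      by (simp add: mult.assoc exp_add[symmetric])
    finally show ?thesis using C by simp
  qed
  moreover have "integrable lborel (\<lambda>x::real^'n. C * exp (s\<^sup>2 / c) * exp (- (c / 4) * (norm x)\<^sup>2))"
    using c by (intro integrable_mult_right integrable_gaussian) simp
  ultimately show ?thesis
    by (intro Bochner_Integration.integrable_bound[OF _ m] always_eventually allI)
qed

section \<open>The algebra of the harmonic oscillator\<close>

lemma smooth_differentiable: "smooth u \<Longrightarrow> u differentiable at x"
  unfolding smooth_iff by (rule smooth_with_differentiable)

lemma smooth_partial: "smooth u \<Longrightarrow> smooth (partial j u)"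
  unfolding smooth_iff by (rule smooth_with_partial)

lemma smooth_commute: "smooth u \<Longrightarrow> partial i (partial j u) = partial j (partial i u)"
  unfolding smooth_iff by (rule smooth_with_commute)

lemma smooth_continuous: "smooth u \<Longrightarrow> continuous_on S u"
  by (rule continuous_differentiable) (rule smooth_differentiable)

lemma smooth_const: "smooth (\<lambda>_. c)"
  unfolding smooth_iff by (rule smooth_with_const) simp

lemma smooth_add: "smooth u \<Longrightarrow> smooth v \<Longrightarrow> smooth (\<lambda>x. u x + v x)"
  unfolding smooth_iff by (erule (1) smooth_with_add) simp

lemma smooth_mult: "smooth u \<Longrightarrow> smooth v \<Longrightarrow> smooth (\<lambda>x. u x * v x)"
  unfolding smooth_iff by (erule (1) smooth_with_mult) simp_all

lemma smooth_coord: "smooth (\<lambda>x. x $ i)"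
  using gauss_coord by (rule smooth_with_smooth)

lemma smooth_cmult: "smooth u \<Longrightarrow> smooth (\<lambda>x. c * u x)"
  by (intro smooth_mult smooth_const)

lemma smooth_minus: "smooth u \<Longrightarrow> smooth (\<lambda>x. - u x)"
  using smooth_cmult[of u "-1"] by simp

lemma smooth_sum: "finite I \<Longrightarrow> (\<And>i. i \<in> I \<Longrightarrow> smooth (u i)) \<Longrightarrow> smooth (\<lambda>x. \<Sum>i\<in>I. u i x)"
proof (induction I rule: finite_induct)
  case empty
  show ?case using smooth_const[of 0] by simp
next
  case (insert i I)
  then show ?case using smooth_add[of "u i" "\<lambda>x. \<Sum>i\<in>I. u i x"] by simp
qed

lemmas smooth_intros = smooth_partial smooth_add smooth_mult smooth_coord smooth_const
  smooth_minus smooth_sum finite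

lemma harmonic_oscillator_eq:
  fixes u :: "real^'n::finite \<Rightarrow> real"
  shows "harmonic_oscillator u = (\<lambda>x. - (\<Sum>j\<in>UNIV. partial j (partial j u) x) + (\<Sum>j\<in>UNIV. x $ j * (x $ j * u x)))"
proof
  fix x :: "real^'n"
  have "(norm x)\<^sup>2 = (\<Sum>j\<in>UNIV. x $ j * x $ j)"
    by (simp add: power2_norm_eq_inner inner_vec_def)
  then show "harmonic_oscillator u x
      = - (\<Sum>j\<in>UNIV. partial j (partial j u) x) + (\<Sum>j\<in>UNIV. x $ j * (x $ j * u x))"
    by (simp add: harmonic_oscillator_def laplacian_def divergence_def gradient_def
        sum_distrib_right mult.assoc)
qed

lemma gauss_harmonic_oscillator:
  assumes "gauss c u"
  shows "gauss c (harmonic_oscillator u)"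
proof -
  have "gauss c (\<lambda>x. (- 1) * (\<Sum>j\<in>UNIV. partial j (partial j u) x) + (\<Sum>j\<in>UNIV. x $ j * (x $ j * u x)))"
    by (intro gauss_add gauss_cmult gauss_sum smooth_with_partial gauss_coord_mult assms)
  then show ?thesis by (simp add: harmonic_oscillator_eq)
qed

lemma harmonic_oscillator_add:
  assumes "smooth u" "smooth v"
  shows "harmonic_oscillator (\<lambda>x. u x + v x) = (\<lambda>x. harmonic_oscillator u x + harmonic_oscillator v x)"
  unfolding harmonic_oscillator_eq
  using assms by (simp add: partial_add smooth_differentiable smooth_partial sum.distrib algebra_simps)

lemma harmonic_oscillator_cmult:
  assumes "smooth u"
  shows "harmonic_oscillator (\<lambda>x. c * u x) = (\<lambda>x. c * harmonic_oscillator u x)"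
  unfolding harmonic_oscillator_eq
  using assms by (simp add: partial_cmult smooth_differentiable smooth_partial sum_distrib_left algebra_simps)

text \<open>
  This commutator with \<open>\<partial>\<^sub>i\<close>, and the one with \<open>x\<^sub>i\<close> below, exchange the two letters; this is why the
  order of \<open>P(\<alpha>)\<close> does not grow when \<open>H\<close> is moved past it.
\<close>

lemma harmonic_oscillator_partial:
  assumes u: "smooth u"
  shows "harmonic_oscillator (partial i u)
    = (\<lambda>x. partial i (harmonic_oscillator u) x + (- 2) * (x $ i * u x))"
proof
  fix x
  have 1: "partial i (\<lambda>x. - (\<Sum>j\<in>UNIV. partial j (partial j u) x))
      = (\<lambda>x. - (\<Sum>j\<in>UNIV. partial j (partial j (partial i u)) x))"
  proof -
    have "partial i (\<lambda>x. (- 1) * (\<Sum>j\<in>UNIV. partial j (partial j u) x))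
      = (\<lambda>x. (- 1) * (\<Sum>j\<in>UNIV. partial i (partial j (partial j u)) x))"
      by (subst partial_cmult, intro smooth_differentiable smooth_intros u,
          subst partial_sum, simp, intro smooth_differentiable smooth_intros u, rule refl)
    moreover have "partial i (partial j (partial j u)) = partial j (partial j (partial i u))" for j
      by (simp add: smooth_commute[of _ i j] smooth_partial u)
    ultimately show ?thesis by simp
  qed
  have 2: "partial i (\<lambda>x. \<Sum>j\<in>UNIV. x $ j * (x $ j * u x))
      = (\<lambda>x. \<Sum>j\<in>UNIV. (if j = i then 2 * (x $ j * u x) else 0) + x $ j * (x $ j * partial i u x))"
    by (subst partial_sum, simp, intro smooth_differentiable smooth_intros u,
        rule ext, rule sum.cong[OF refl], subst partial_coord_mult,
        intro smooth_differentiable smooth_intros u, subst partial_coord_mult,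
        intro smooth_differentiable smooth_intros u) (simp add: algebra_simps)
  have "partial i (harmonic_oscillator u) x = - (\<Sum>j\<in>UNIV. partial j (partial j (partial i u)) x)
      + (\<Sum>j\<in>UNIV. (if j = i then 2 * (x $ j * u x) else 0) + x $ j * (x $ j * partial i u x))"
    unfolding harmonic_oscillator_eq
    by (subst partial_add) (auto intro!: smooth_differentiable smooth_intros u simp: 1 2)
  then show "harmonic_oscillator (partial i u) x
      = partial i (harmonic_oscillator u) x + (- 2) * (x $ i * u x)"
    by (simp add: harmonic_oscillator_eq sum.distrib)
qed

lemma partial_partial_mult:
  assumes "smooth u" "smooth v"
  shows "partial j (partial j (\<lambda>x. u x * v x)) = (\<lambda>x. partial j (partial j u) x * v x
    + 2 * (partial j u x * partial j v x) + u x * partial j (partial j v) x)"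
  using assms by (subst partial_mult, auto intro!: smooth_differentiable,
    subst partial_add, auto intro!: smooth_differentiable smooth_intros,
    auto simp: partial_mult smooth_differentiable smooth_partial algebra_simps)

lemma harmonic_oscillator_coord_mult:
  assumes u: "smooth u"
  shows "harmonic_oscillator (\<lambda>x. x $ i * u x)
    = (\<lambda>x. x $ i * harmonic_oscillator u x + (- 2) * partial i u x)"
proof
  fix x
  have "partial j (partial j (\<lambda>x. x $ i * u x)) x
      = (if j = i then 2 * partial j u x else 0) + x $ i * partial j (partial j u) x" for j
    using partial_partial_mult[OF smooth_coord u, of j i]
    by (auto simp: partial_coord partial_const)
  then show "harmonic_oscillator (\<lambda>x. x $ i * u x) x
      = x $ i * harmonic_oscillator u x + (- 2) * partial i u x"
    by (simp add: harmonic_oscillator_eq sum.distrib sum_distrib_left algebra_simps)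
qed

text \<open>
  The cross terms of the Laplacian give the scalar products of gradients. The potential occurs once on
  the left but three times on the right; the surplus \<open>2 |x|\<^sup>2 u v w\<close> is written as
  \<open>2 (x u) \<cdot> (x v) w\<close>, so that no factor gains more than one letter.
\<close>

lemma harmonic_oscillator_mult3:
  assumes "smooth u" "smooth v" "smooth w"
  shows "harmonic_oscillator (\<lambda>x. u x * v x * w x) x =
    harmonic_oscillator u x * v x * w x + u x * harmonic_oscillator v x * w x
    + u x * v x * harmonic_oscillator w x
    - 2 * (\<Sum>j\<in>UNIV. partial j u x * partial j v x * w x + partial j u x * v x * partial j w x
        + u x * partial j v x * partial j w x + (x $ j * u x) * (x $ j * v x) * w x)"
proof -
  have "partial j (partial j (\<lambda>x. u x * v x * w x)) x =
      partial j (partial j u) x * v x * w x + u x * partial j (partial j v) x * w x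
      + u x * v x * partial j (partial j w) x
      + 2 * (partial j u x * partial j v x * w x + partial j u x * v x * partial j w x
        + u x * partial j v x * partial j w x)" for j
    using partial_partial_mult[OF smooth_mult[OF assms(1,2)] assms(3), of j]
      partial_partial_mult[OF assms(1,2), of j]
      partial_mult[OF smooth_differentiable[OF assms(1)] smooth_differentiable[OF assms(2)], of j]
    by (simp add: algebra_simps)
  then show ?thesis
    by (simp add: harmonic_oscillator_eq sum.distrib sum_distrib_left sum_distrib_right algebra_simps)
qed

section \<open>Integration by parts\<close>

lemma integral_translation:
  fixes f :: "real^'n::finite \<Rightarrow> real"
  assumes "f \<in> borel_measurable borel"
  shows "(\<integral>x. f (x + c) \<partial>lborel) = (\<integral>x. f x \<partial>lborel)"
    and "integrable lborel (\<lambda>x. f (x + c)) \<longleftrightarrow> integrable lborel f"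
  using integral_distr[of "(+) c" lborel borel f] integrable_distr_eq[of "(+) c" lborel borel f] assms
  by (simp_all add: lborel_distr_plus add.commute[of c])

text \<open>
  Average the translates of \<open>\<partial>\<^sub>jF\<close> along a unit step: by translation invariance this does not
  change the integral, and by the fundamental theorem the average is \<open>F(x + e\<^sub>j) - F(x)\<close>, of integral zero.
\<close>

lemma integral_partial_eq_0:
  fixes F :: "real^'n::finite \<Rightarrow> real"
  assumes d: "\<And>x. F differentiable at x" and c: "continuous_on UNIV (partial j F)"
    and F: "integrable lborel F" and dF: "integrable lborel (partial j F)"
  shows "(\<integral>x. partial j F x \<partial>lborel) = 0"
proof -
  let ?e = "axis j 1 :: real^'n"
  define f where "f s x = partial j F (x + s *\<^sub>R ?e) * indicator {0..1} s" for s :: real and x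
  have m: "partial j F \<in> borel_measurable borel" "F \<in> borel_measurable borel"
    using c continuous_differentiable[OF d, of UNIV] by (auto intro: borel_measurable_continuous_onI)
  note m(1)[measurable]
  have mf: "case_prod f \<in> borel_measurable (lborel \<Otimes>\<^sub>M lborel)"
    unfolding f_def split_beta by measurable
  have int_f: "integrable lborel (f s)" for s
    unfolding f_def using integral_translation(2)[OF m(1), of "s *\<^sub>R ?e"] dF
    by (intro integrable_mult_left) simp
  have "(\<integral>x. norm (f s x) \<partial>lborel) = (\<integral>x. \<bar>partial j F x\<bar> \<partial>lborel) * indicator {0..1} s" for s
  proof -
    have "(\<integral>x. norm (f s x) \<partial>lborel) = (\<integral>x. \<bar>partial j F (x + s *\<^sub>R ?e)\<bar> * indicator {0..1} s \<partial>lborel)"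
      by (simp add: f_def abs_mult)
    also have "\<dots> = (\<integral>x. \<bar>partial j F (x + s *\<^sub>R ?e)\<bar> \<partial>lborel) * indicator {0..1} s"
      by simp
    also have "(\<integral>x. \<bar>partial j F (x + s *\<^sub>R ?e)\<bar> \<partial>lborel) = (\<integral>x. \<bar>partial j F x\<bar> \<partial>lborel)"
      by (rule integral_translation(1)) measurable
    finally show ?thesis .
  qed
  then have "integrable lborel (\<lambda>s. \<integral>x. norm (f s x) \<partial>lborel)" by simp
  then have "integrable (lborel \<Otimes>\<^sub>M lborel) (case_prod f)"
    using mf int_f by (intro lborel_pair.Fubini_integrable) auto
  from lborel_pair.Fubini_integral[OF this]
  have "(\<integral>x. \<integral>s. f s x \<partial>lborel \<partial>lborel) = (\<integral>s. \<integral>x. f s x \<partial>lborel \<partial>lborel)" .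
  also have "(\<lambda>s. \<integral>x. f s x \<partial>lborel) = (\<lambda>s. (\<integral>x. partial j F x \<partial>lborel) * indicator {0..1} s)"
    unfolding f_def using integral_translation(1)[OF m(1)] by simp
  also have "(\<integral>s. (\<integral>x. partial j F x \<partial>lborel) * indicator {0..1::real} s \<partial>lborel) = (\<integral>x. partial j F x \<partial>lborel)"
    by simp
  also have "(\<lambda>x. \<integral>s. f s x \<partial>lborel) = (\<lambda>x. F (x + ?e) - F x)"
  proof
    fix x
    have "isCont (\<lambda>s. partial j F (x + s *\<^sub>R ?e)) t" for t
    proof -
      have "continuous_on UNIV (\<lambda>s. partial j F (x + s *\<^sub>R ?e))"
        by (rule continuous_on_compose2[OF c]) (auto intro!: continuous_intros)
      then show ?thesis by (simp add: continuous_on_eq_continuous_at)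
    qed
    with has_real_derivative_along_axis[OF d, where x = x and j = j]
    have "(\<integral>s. partial j F (x + s *\<^sub>R ?e) * indicator {0..1} s \<partial>lborel)
        = F (x + 1 *\<^sub>R ?e) - F (x + 0 *\<^sub>R ?e)"
      by (intro integral_FTC_Icc_real) auto
    then show "(\<integral>s. f s x \<partial>lborel) = F (x + ?e) - F x" by (simp add: f_def)
  qed
  also have "(\<integral>x. F (x + ?e) - F x \<partial>lborel) = 0"
    using integral_translation[OF m(2), of ?e] F by simp
  finally show ?thesis by simp
qed

text \<open>Green's formula: the difference of the integrands is the divergence of \<open>u \<nabla>v - v \<nabla>u\<close>.\<close>

lemma harmonic_oscillator_symmetric:
  assumes u: "gauss a u" and v: "gauss b v" and ab: "a + b > 0"
  shows "(\<integral>x. harmonic_oscillator u x * v x \<partial>lborel) = (\<integral>x. u x * harmonic_oscillator v x \<partial>lborel)"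
proof -
  note su = smooth_with_smooth[OF u] and sv = smooth_with_smooth[OF v]
  define F where "F j x = u x * partial j v x + (-1) * (partial j u x * v x)" for j x
  have gF: "gauss (a + b) (F j)" for j
    unfolding F_def by (intro gauss_add gauss_cmult gauss_mult smooth_with_partial u v)
  have dF: "partial j (F j) = (\<lambda>x. u x * partial j (partial j v) x + (- 1) * (partial j (partial j u) x * v x))" for j
    unfolding F_def by (subst partial_add, (intro smooth_differentiable smooth_intros su sv)+,
        subst partial_cmult, (intro smooth_differentiable smooth_intros su sv)+)
      (simp add: partial_mult smooth_differentiable smooth_partial su sv)
  have F0: "(\<integral>x. partial j (F j) x \<partial>lborel) = 0" for j
    by (intro integral_partial_eq_0 gauss_integrable[OF _ ab] gF smooth_with_partial[OF gF]
        smooth_with_differentiable[OF gF] continuous_differentiable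
        smooth_with_differentiable[OF smooth_with_partial[OF gF]])
  have "harmonic_oscillator u x * v x - u x * harmonic_oscillator v x = (\<Sum>j\<in>UNIV. partial j (F j) x)" for x
    by (simp add: dF harmonic_oscillator_eq sum_subtractf sum_distrib_left sum_distrib_right algebra_simps)
  then have "(\<integral>x. harmonic_oscillator u x * v x - u x * harmonic_oscillator v x \<partial>lborel)
      = (\<integral>x. (\<Sum>j\<in>UNIV. partial j (F j) x) \<partial>lborel)" by simp
  also have "\<dots> = (\<Sum>j\<in>UNIV. \<integral>x. partial j (F j) x \<partial>lborel)"
    by (rule Bochner_Integration.integral_sum) (rule gauss_integrable[OF smooth_with_partial[OF gF] ab])
  also have "\<dots> = 0" by (simp add: F0)
  finally show ?thesis
    using gauss_integrable[OF gauss_mult[OF gauss_harmonic_oscillator[OF u] v] ab]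
      gauss_integrable[OF gauss_mult[OF u gauss_harmonic_oscillator[OF v]] ab] by simp
qed

section \<open>Gaussian decay of eigenfunctions\<close>

definition annihilation :: "'n::finite \<Rightarrow> (real^'n \<Rightarrow> real) \<Rightarrow> real^'n \<Rightarrow> real" where
  "annihilation j u = (\<lambda>x. partial j u x + x $ j * u x)"

lemma smooth_annihilation: "smooth u \<Longrightarrow> smooth (annihilation j u)"
  unfolding annihilation_def by (intro smooth_intros)

text \<open>Adding the two commutators gives \<open>[H, A\<^sub>j] = -2 A\<^sub>j\<close> for \<open>A\<^sub>j = \<partial>\<^sub>j + x\<^sub>j\<close>.\<close>

lemma harmonic_oscillator_annihilation:
  assumes u: "smooth u" and H: "harmonic_oscillator u = (\<lambda>x. lam * u x)"
  shows "harmonic_oscillator (annihilation j u) = (\<lambda>x. (lam - 2) * annihilation j u x)"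
proof -
  have "harmonic_oscillator (annihilation j u) = (\<lambda>x. harmonic_oscillator (partial j u) x
      + harmonic_oscillator (\<lambda>x. x $ j * u x) x)"
    unfolding annihilation_def by (intro harmonic_oscillator_add smooth_intros u)
  moreover have "partial j (\<lambda>x. lam * u x) = (\<lambda>x. lam * partial j u x)"
    by (intro partial_cmult smooth_differentiable u)
  ultimately show ?thesis
    unfolding harmonic_oscillator_partial[OF u] harmonic_oscillator_coord_mult[OF u] H
    by (simp add: annihilation_def algebra_simps)
qed

text \<open>The outer square makes this \<open>C\<^sup>1\<close>. It tends to \<open>1\<close> pointwise as \<open>a\<close> tends to \<open>0\<close>.\<close>

definition cutoff :: "real \<Rightarrow> real^'n::finite \<Rightarrow> real" where
  "cutoff a x = (max 0 (1 - a * (norm x)\<^sup>2))\<^sup>2"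

text \<open>The error of the linear approximation is at most \<open>(s - t)\<^sup>2\<close>, also across the kink.\<close>

lemma DERIV_max_0_square: "((\<lambda>s. (max 0 s)\<^sup>2) has_real_derivative 2 * max 0 t) (at t)"
proof -
  have b: "\<bar>(max 0 s)\<^sup>2 - (max 0 t)\<^sup>2 - 2 * max 0 t * (s - t)\<bar> \<le> (s - t)\<^sup>2" for s :: real
  proof -
    consider "s \<ge> 0" "t \<ge> 0" | "s \<ge> 0" "t < 0" | "s < 0" "t \<ge> 0" | "s < 0" "t < 0" by linarith
    then show ?thesis
    proof cases
      case 1
      have "s\<^sup>2 - t\<^sup>2 - 2 * t * (s - t) = (s - t)\<^sup>2" by (simp add: power2_eq_square algebra_simps)
      with 1 show ?thesis by simp
    next
      case 2
      then have "s\<^sup>2 \<le> (s - t)\<^sup>2" by (intro power_mono) auto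
      with 2 show ?thesis by simp
    next
      case 3
      have "- t\<^sup>2 - 2 * t * (s - t) = t\<^sup>2 - 2 * s * t" by (simp add: power2_eq_square algebra_simps)
      moreover have "(s - t)\<^sup>2 = s\<^sup>2 + (t\<^sup>2 - 2 * s * t)" by (simp add: power2_eq_square algebra_simps)
      moreover have "t\<^sup>2 - 2 * s * t \<ge> 0" using 3 mult_nonpos_nonneg[of s t] zero_le_power2[of t] by linarith
      ultimately show ?thesis using 3 by simp
    qed simp
  qed
  have "((\<lambda>s. ((max 0 s)\<^sup>2 - (max 0 t)\<^sup>2) / (s - t) - 2 * max 0 t) \<longlongrightarrow> 0) (at t)"
  proof (rule Lim_null_comparison)
    show "\<forall>\<^sub>F s in at t. norm (((max 0 s)\<^sup>2 - (max 0 t)\<^sup>2) / (s - t) - 2 * max 0 t) \<le> \<bar>s - t\<bar>"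
      unfolding eventually_at_filter
    proof (intro always_eventually allI impI)
      fix s :: real assume "s \<noteq> t"
      then have "((max 0 s)\<^sup>2 - (max 0 t)\<^sup>2) / (s - t) - 2 * max 0 t
          = ((max 0 s)\<^sup>2 - (max 0 t)\<^sup>2 - 2 * max 0 t * (s - t)) / (s - t)"
        by (simp add: diff_divide_distrib)
      also have "\<bar>\<dots>\<bar> \<le> (s - t)\<^sup>2 / \<bar>s - t\<bar>"
        using b[of s] by (simp add: abs_divide divide_right_mono)
      also have "\<dots> = \<bar>s - t\<bar>"
        using \<open>s \<noteq> t\<close> by (simp add: field_simps power2_eq_square)
      finally show "norm (((max 0 s)\<^sup>2 - (max 0 t)\<^sup>2) / (s - t) - 2 * max 0 t) \<le> \<bar>s - t\<bar>" by simp
    qed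
    have "((\<lambda>s. \<bar>s - t\<bar>) \<longlongrightarrow> \<bar>t - t\<bar>) (at t)" by (intro tendsto_intros)
    then show "((\<lambda>s. \<bar>s - t\<bar>) \<longlongrightarrow> 0) (at t)" by simp
  qed
  then show ?thesis
    unfolding has_field_derivative_iff by (subst LIM_zero_iff[symmetric]) simp
qed

lemma has_derivative_cutoff:
  fixes x :: "real^'n::finite"
  shows "(cutoff a has_derivative (\<lambda>h. 2 * max 0 (1 - a * (norm x)\<^sup>2) * (- a * (2 * (x \<bullet> h))))) (at x)"
proof -
  have "((\<lambda>x::real^'n. 1 - a * (x \<bullet> x)) has_derivative (\<lambda>h. - a * (2 * (x \<bullet> h)))) (at x)"
    by (auto intro!: derivative_eq_intros simp: inner_commute)
  from has_derivative_compose[OF this has_field_derivative_imp_has_derivative[OF DERIV_max_0_square]]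
  show ?thesis unfolding cutoff_def power2_norm_eq_inner by simp
qed

lemma differentiable_cutoff: "cutoff a differentiable at x"
  using has_derivative_cutoff by (auto simp: differentiable_def)

lemma partial_cutoff:
  "partial j (cutoff a :: real^'n::finite \<Rightarrow> real) = (\<lambda>x. - 4 * a * x $ j * max 0 (1 - a * (norm x)\<^sup>2))"
proof
  fix x :: "real^'n"
  from partial_eqI[OF has_derivative_cutoff]
  show "partial j (cutoff a) x = - 4 * a * x $ j * max 0 (1 - a * (norm x)\<^sup>2)"
    by (simp add: inner_axis mult_ac)
qed

lemma continuous_on_cutoff: "continuous_on S (cutoff a)"
  by (rule continuous_differentiable) (rule differentiable_cutoff)

lemma cutoff_bounds: 
  assumes "a > 0" 
  shows "0 \<le> cutoff a x" "cutoff a x \<le> 1"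
proof -
  have "max 0 (1 - a * (norm x)\<^sup>2) \<le> 1" using assms by simp
  then show "cutoff a x \<le> 1" unfolding cutoff_def by (intro power_le_one) auto
qed (simp add: cutoff_def)

lemma cutoff_tendsto_1: "(\<lambda>n. cutoff (1 / real (Suc n)) x) \<longlonglongrightarrow> 1"
proof -
  have "(\<lambda>n. (max 0 (1 - (1 / real (Suc n)) * (norm x)\<^sup>2))\<^sup>2) \<longlonglongrightarrow> (max 0 (1 - 0 * (norm x)\<^sup>2))\<^sup>2"
    by (intro tendsto_intros LIMSEQ_Suc[OF lim_1_over_n])
  then show ?thesis by (simp add: cutoff_def)
qed

lemma integrable_compact_support:
  fixes f :: "real^'n::finite \<Rightarrow> real"
  assumes c: "continuous_on UNIV f" and a: "a > 0"
    and supp: "\<And>x. a * (norm x)\<^sup>2 \<ge> 1 \<Longrightarrow> f x = 0"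
  shows "integrable lborel f"
proof -
  let ?K = "cball 0 (1 / sqrt a) :: (real^'n) set"
  have "indicator ?K x *\<^sub>R f x = f x" for x
  proof (cases "x \<in> ?K")
    case False
    then have "1 / sqrt a \<le> norm x" by simp
    then have "1 \<le> sqrt a * norm x" using a by (simp add: field_simps)
    from power_mono[OF this, of 2] have "a * (norm x)\<^sup>2 \<ge> 1" using a by (simp add: power_mult_distrib)
    with supp show ?thesis by simp
  qed simp
  then have "f = (\<lambda>x. indicator ?K x *\<^sub>R f x)" by presburger
  moreover have "integrable lborel (\<lambda>x. indicator ?K x *\<^sub>R f x)"
    by (rule borel_integrable_compact[OF compact_cball continuous_on_subset[OF c subset_UNIV]])
  ultimately show ?thesis by simp
qed

text \<open>
  The energy identity \<open>\<Sum>\<^sub>j \<parallel>A\<^sub>j u\<parallel>\<^sup>2 = (\<lambda> - d) \<parallel>u\<parallel>\<^sup>2\<close> for the annihilation operators \<open>A\<^sub>j\<close>, localised: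
  \<open>\<phi> u A\<^sub>j u\<close> has compact support, so its \<open>j\<close>-th derivative integrates to zero, and the terms with
  \<open>\<nabla>\<phi>\<close> are absorbed by half of the left-hand side.
\<close>

lemma local_energy_estimate:
  fixes u :: "real^'n::finite \<Rightarrow> real"
  assumes u: "smooth u" and H: "harmonic_oscillator u = (\<lambda>x. lam * u x)"
    and L2: "integrable lborel (\<lambda>x. (u x)\<^sup>2)" and a: "a > 0"
  defines "E \<equiv> \<lambda>x. cutoff a x * (\<Sum>j\<in>UNIV. (annihilation j u x)\<^sup>2)"
  shows "integrable lborel E" (is ?int)
    and "(\<integral>x. E x \<partial>lborel) \<le> 2 * (lam - CARD('n)) * (\<integral>x. cutoff a x * (u x)\<^sup>2 \<partial>lborel)
      + 16 * a * (\<integral>x. (u x)\<^sup>2 \<partial>lborel)" (is ?ineq)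
proof -
  define \<psi> where "\<psi> x = max 0 (1 - a * (norm x)\<^sup>2)" for x :: "real^'n"
  define A where "A j = annihilation j u" for j
  define \<mu> where "\<mu> = lam - CARD('n)"
  define F where "F j x = cutoff a x * (u x * A j x)" for j x
  have sA: "smooth (A j)" for j unfolding A_def by (rule smooth_annihilation[OF u])
  have c\<psi>: "cutoff a x = (\<psi> x)\<^sup>2" for x by (simp add: cutoff_def \<psi>_def)
  have supp: "\<psi> x = 0" if "a * (norm x)\<^sup>2 \<ge> 1" for x using that by (simp add: \<psi>_def)
  have cont\<psi>: "continuous_on UNIV \<psi>"
    unfolding \<psi>_def by (intro continuous_intros)
  note cont = continuous_intros cont\<psi> continuous_on_cutoff smooth_continuous[OF u]
    smooth_continuous[OF sA] smooth_continuous[OF smooth_partial[OF u]]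
    smooth_continuous[OF smooth_partial[OF sA]]
  have dF: "partial j (F j) = (\<lambda>x. - 4 * a * x $ j * \<psi> x * (u x * A j x)
      + cutoff a x * (partial j u x * A j x + u x * partial j (A j) x))" for j
    unfolding F_def \<psi>_def by (subst partial_mult,
        intro differentiable_cutoff differentiable_mult smooth_differentiable u sA,
        intro differentiable_cutoff differentiable_mult smooth_differentiable u sA)
      (simp add: partial_mult smooth_differentiable u sA partial_cutoff)
  have diffF: "F j differentiable at x" for j x
    unfolding F_def by (intro differentiable_cutoff differentiable_mult smooth_differentiable u sA)
  have contdF: "continuous_on UNIV (partial j (F j))" for j
    unfolding dF by (intro cont)
  have intF: "integrable lborel (F j)" for j
    by (rule integrable_compact_support[OF continuous_differentiable[OF diffF] a])
      (simp add: F_def c\<psi> supp)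
  have intdF: "integrable lborel (partial j (F j))" for j
    by (rule integrable_compact_support[OF contdF a]) (simp add: dF c\<psi> supp)
  have "(\<integral>x. (\<Sum>j\<in>UNIV. partial j (F j) x) \<partial>lborel) = (\<Sum>j\<in>UNIV. \<integral>x. partial j (F j) x \<partial>lborel)"
    by (rule Bochner_Integration.integral_sum) (rule intdF)
  also have "\<dots> = 0"
    using integral_partial_eq_0[OF diffF contdF intF intdF] by simp
  finally have zero: "(\<integral>x. (\<Sum>j\<in>UNIV. partial j (F j) x) \<partial>lborel) = 0" .
  show int: ?int
    unfolding E_def A_def[symmetric]
    by (rule integrable_compact_support[OF _ a]) (auto intro!: cont simp: c\<psi> supp)
  have intu: "integrable lborel (\<lambda>x. cutoff a x * (u x)\<^sup>2)"
    by (rule integrable_compact_support[OF _ a]) (auto intro!: cont simp: c\<psi> supp)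
  (* the factorisation of H - d as the sum of (x_j - partial_j) A_j *)
  have factor: "(\<Sum>j\<in>UNIV. x $ j * A j x - partial j (A j) x) = \<mu> * u x" for x
  proof -
    have "x $ j * A j x - partial j (A j) x
        = - partial j (partial j u) x + x $ j * (x $ j * u x) - u x" for j
      unfolding A_def annihilation_def
      by (subst partial_add, (intro smooth_differentiable smooth_intros u)+,
          subst partial_coord_mult, (intro smooth_differentiable smooth_intros u)+)
        (simp add: algebra_simps)
    then have "(\<Sum>j\<in>UNIV. x $ j * A j x - partial j (A j) x) = harmonic_oscillator u x - CARD('n) * u x"
      by (simp add: harmonic_oscillator_eq sum.distrib sum_subtractf sum_negf)
    then show ?thesis by (simp add: H \<mu>_def algebra_simps)
  qed
  have ptw: "(1 / 2) * E x - \<mu> * (cutoff a x * (u x)\<^sup>2) - 8 * a * (u x)\<^sup>2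
      \<le> (\<Sum>j\<in>UNIV. partial j (F j) x)" for x
  proof -
    have "partial j (F j) x = - 4 * a * x $ j * \<psi> x * (u x * A j x) + cutoff a x * (A j x)\<^sup>2
        - cutoff a x * u x * (x $ j * A j x - partial j (A j) x)" for j
      by (simp add: dF A_def annihilation_def power2_eq_square algebra_simps)
    then have "(\<Sum>j\<in>UNIV. partial j (F j) x) = (\<Sum>j\<in>UNIV. - 4 * a * x $ j * \<psi> x * (u x * A j x))
        + E x - cutoff a x * u x * (\<mu> * u x)"
      unfolding factor[symmetric] E_def A_def[symmetric] sum_distrib_left
      by (simp only: sum.distrib sum_subtractf)
    moreover have "(\<Sum>j\<in>UNIV. - 4 * a * x $ j * \<psi> x * (u x * A j x)) \<ge> - (1 / 2) * E x - 8 * a * (u x)\<^sup>2"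
    proof (cases "a * (norm x)\<^sup>2 \<ge> 1")
      case True
      then have "- (1 / 2) * E x = 0" by (simp add: E_def c\<psi> supp)
      then show ?thesis using True a by (simp add: supp)
    next
      case False
      have "- (1 / 2) * E x - 8 * a * (u x)\<^sup>2 \<le> - (1 / 2) * E x - 8 * a * (u x)\<^sup>2 * (a * (norm x)\<^sup>2)"
        using False a mult_left_le[of "a * (norm x)\<^sup>2" "8 * a * (u x)\<^sup>2"] by simp
      also have "\<dots> = (\<Sum>j\<in>UNIV. - (1 / 2) * (\<psi> x * A j x)\<^sup>2 - 8 * (a * x $ j * u x)\<^sup>2)"
      proof -
        have "(norm x)\<^sup>2 = (\<Sum>j\<in>UNIV. (x $ j)\<^sup>2)"
          unfolding power2_norm_eq_inner by (simp add: inner_vec_def power2_eq_square)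
        then show ?thesis
          by (simp add: E_def c\<psi> A_def sum_subtractf sum_distrib_left sum_negf power2_eq_square mult_ac)
      qed
      also have "\<dots> \<le> (\<Sum>j\<in>UNIV. - 4 * a * x $ j * \<psi> x * (u x * A j x))"
      proof (rule sum_mono)
        fix j
        (* 4 p q \<le> p^2 / 2 + 8 q^2 with p = psi A_j u and q = a x_j u *)
        have "0 \<le> (\<psi> x * A j x - 4 * (a * x $ j * u x))\<^sup>2 / 2" by simp
        then show "- (1 / 2) * (\<psi> x * A j x)\<^sup>2 - 8 * (a * x $ j * u x)\<^sup>2
            \<le> - 4 * a * x $ j * \<psi> x * (u x * A j x)"
          by (simp add: power2_eq_square algebra_simps)
      qed
      finally show ?thesis .
    qed
    ultimately show ?thesis by (simp add: power2_eq_square algebra_simps)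
  qed
  have "(\<integral>x. (1 / 2) * E x - \<mu> * (cutoff a x * (u x)\<^sup>2) - 8 * a * (u x)\<^sup>2 \<partial>lborel)
      \<le> (\<integral>x. (\<Sum>j\<in>UNIV. partial j (F j) x) \<partial>lborel)"
    by (rule integral_mono[OF _ _ ptw])
      (intro Bochner_Integration.integrable_diff Bochner_Integration.integrable_sum
        integrable_mult_right int intu L2 intdF)+
  then show ?ineq
    using int intu L2 by (simp add: zero \<mu>_def[symmetric])
qed


text \<open>
  Let \<open>a\<close> tend to \<open>0\<close> in the local estimate: Fatou's lemma on the left, dominated convergence on the
  right. The second claim keeps only that the left-hand side is nonnegative.
\<close>

lemma energy_estimate:
  fixes u :: "real^'n::finite \<Rightarrow> real"
  assumes u: "smooth u" and H: "harmonic_oscillator u = (\<lambda>x. lam * u x)"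
    and L2: "integrable lborel (\<lambda>x. (u x)\<^sup>2)"
  shows "integrable lborel (\<lambda>x. (annihilation j u x)\<^sup>2)"
    and "0 \<le> (lam - CARD('n)) * (\<integral>x. (u x)\<^sup>2 \<partial>lborel)"
proof -
  define a where "a n = 1 / real (Suc n)" for n
  define E where "E n x = cutoff (a n) x * (\<Sum>j\<in>UNIV. (annihilation j u x)\<^sup>2)" for n x
  define \<mu> where "\<mu> = lam - CARD('n)"
  define M where "M = (\<integral>x. (u x)\<^sup>2 \<partial>lborel)"
  define N where "N n = (\<integral>x. cutoff (a n) x * (u x)\<^sup>2 \<partial>lborel)" for n
  have a: "a n > 0" "a n \<le> 1" for n by (simp_all add: a_def)
  note est = local_energy_estimate[OF u H L2 a(1), folded E_def \<mu>_def M_def N_def]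
  have mu: "u \<in> borel_measurable lborel"
    using smooth_continuous[OF u, of UNIV] by (simp add: borel_measurable_continuous_onI)
  have mA: "annihilation j u \<in> borel_measurable lborel" for j
    using smooth_continuous[OF smooth_annihilation[OF u], of UNIV]
    by (simp add: borel_measurable_continuous_onI)
  have mc: "(cutoff b :: real^'n \<Rightarrow> real) \<in> borel_measurable lborel" for b :: real
    using continuous_on_cutoff[of "UNIV :: (real^'n) set" b] by (simp add: borel_measurable_continuous_onI)
  note mu[measurable] mA[measurable] mc[measurable]
  have lim_cutoff: "(\<lambda>n. cutoff (a n) x) \<longlonglongrightarrow> 1" for x :: "real^'n"
    unfolding a_def by (rule cutoff_tendsto_1)
  have N: "N \<longlonglongrightarrow> M"
    unfolding N_def M_def
  proof (rule integral_dominated_convergence[where w = "\<lambda>x. (u x)\<^sup>2"])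
    show "AE x in lborel. (\<lambda>n. cutoff (a n) x * (u x)\<^sup>2) \<longlonglongrightarrow> (u x)\<^sup>2"
      using tendsto_mult[OF lim_cutoff tendsto_const] by (intro always_eventually allI) simp
    show "AE x in lborel. norm (cutoff (a n) x * (u x)\<^sup>2) \<le> (u x)\<^sup>2" for n
      by (intro always_eventually allI) (simp add: abs_mult cutoff_bounds[OF a(1)] mult_left_le_one_le)
  qed (use L2 in measurable)
  have N_le: "N n \<le> M" "0 \<le> N n" for n
  proof -
    have "integrable lborel (\<lambda>x. cutoff (a n) x * (u x)\<^sup>2)"
      by (rule Bochner_Integration.integrable_bound[OF L2], measurable)
        (simp add: abs_mult cutoff_bounds[OF a(1)] mult_left_le_one_le)
    then show "N n \<le> M" unfolding N_def M_def
      by (rule integral_mono[OF _ L2]) (simp add: cutoff_bounds[OF a(1)] mult_left_le_one_le)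
    show "0 \<le> N n" unfolding N_def
      by (intro integral_nonneg_AE always_eventually allI) (simp add: cutoff_bounds[OF a(1)])
  qed
  have M: "M \<ge> 0" unfolding M_def by (intro integral_nonneg_AE) auto
  have E_nonneg: "E n x \<ge> 0" for n x
    unfolding E_def using cutoff_bounds[OF a(1)[of n]] by (intro mult_nonneg_nonneg sum_nonneg) auto
  define K where "K = 2 * \<bar>\<mu>\<bar> * M + 16 * M"
  have EK: "(\<integral>\<^sup>+x. ennreal (E n x) \<partial>lborel) \<le> ennreal K" for n
  proof -
    have "\<mu> * N n \<le> \<bar>\<mu>\<bar> * M"
      using N_le[of n] by (intro mult_mono) auto
    moreover have "a n * M \<le> 1 * M" using a(2) M by (rule mult_right_mono)
    ultimately have "(\<integral>x. E n x \<partial>lborel) \<le> K"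
      using est(2)[of n] by (simp add: K_def)
    then show ?thesis
      using nn_integral_eq_integral[OF est(1)[of n]] E_nonneg by (simp add: ennreal_leI)
  qed
  have "(\<integral>\<^sup>+x. ennreal (\<Sum>j\<in>UNIV. (annihilation j u x)\<^sup>2) \<partial>lborel)
      = (\<integral>\<^sup>+x. liminf (\<lambda>n. ennreal (E n x)) \<partial>lborel)"
  proof (intro nn_integral_cong)
    fix x :: "real^'n"
    have "(\<lambda>n. E n x) \<longlonglongrightarrow> 1 * (\<Sum>j\<in>UNIV. (annihilation j u x)\<^sup>2)"
      unfolding E_def by (intro tendsto_mult lim_cutoff tendsto_const)
    then have "(\<lambda>n. ennreal (E n x)) \<longlonglongrightarrow> ennreal (\<Sum>j\<in>UNIV. (annihilation j u x)\<^sup>2)"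
      by (intro tendsto_ennrealI) simp
    then show "ennreal (\<Sum>j\<in>UNIV. (annihilation j u x)\<^sup>2) = liminf (\<lambda>n. ennreal (E n x))"
      by (simp add: lim_imp_Liminf)
  qed
  also have "\<dots> \<le> liminf (\<lambda>n. \<integral>\<^sup>+x. ennreal (E n x) \<partial>lborel)"
    by (rule nn_integral_liminf) (unfold E_def, measurable)
  also have "\<dots> \<le> liminf (\<lambda>n. ennreal K)"
    by (intro Liminf_mono always_eventually allI EK)
  also have "\<dots> = ennreal K" by (simp add: Liminf_const)
  finally have fin: "(\<integral>\<^sup>+x. ennreal (\<Sum>j\<in>UNIV. (annihilation j u x)\<^sup>2) \<partial>lborel) \<le> ennreal K" .
  have "integrable lborel (\<lambda>x. \<Sum>j\<in>UNIV. (annihilation j u x)\<^sup>2)"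
  proof (rule integrableI_nonneg)
    show "(\<integral>\<^sup>+x. ennreal (\<Sum>j\<in>UNIV. (annihilation j u x)\<^sup>2) \<partial>lborel) < \<infinity>"
      using fin by (rule le_less_trans) simp
  qed (auto intro!: sum_nonneg)
  then show "integrable lborel (\<lambda>x. (annihilation j u x)\<^sup>2)"
  proof (rule Bochner_Integration.integrable_bound)
    show "AE x in lborel. norm ((annihilation j u x)\<^sup>2) \<le> norm (\<Sum>j\<in>UNIV. (annihilation j u x)\<^sup>2)"
      by (intro always_eventually allI) (auto simp: sum_nonneg intro: member_le_sum)
  qed measurable
  have "0 \<le> 2 * \<mu> * N n + 16 * a n * M" for n
  proof -
    have "0 \<le> (\<integral>x. E n x \<partial>lborel)" by (intro integral_nonneg_AE always_eventually allI E_nonneg)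
    then show ?thesis using est(2)[of n] by simp
  qed
  moreover have "(\<lambda>n. 2 * \<mu> * N n + 16 * a n * M) \<longlonglongrightarrow> 2 * \<mu> * M + 16 * 0 * M"
    unfolding a_def by (intro tendsto_intros N LIMSEQ_Suc[OF lim_1_over_n])
  ultimately have "0 \<le> 2 * \<mu> * M + 16 * 0 * M"
    by (intro LIMSEQ_le_const) auto
  then have "0 \<le> \<mu> * M" by (simp add: mult.commute)
  then show "0 \<le> (lam - CARD('n)) * (\<integral>x. (u x)\<^sup>2 \<partial>lborel)"
    by (simp only: \<mu>_def M_def)
qed

lemma continuous_integral_square_eq_0:
  fixes u :: "real^'n::finite \<Rightarrow> real"
  assumes c: "continuous_on UNIV u" and L2: "integrable lborel (\<lambda>x. (u x)\<^sup>2)"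
    and 0: "(\<integral>x. (u x)\<^sup>2 \<partial>lborel) = 0"
  shows "u = (\<lambda>_. 0)"
proof -
  let ?S = "{x. u x \<noteq> 0}"
  have op: "open ?S"
    by (intro open_Collect_neq c continuous_on_const)
  have "AE x in lborel. (u x)\<^sup>2 = 0"
    using 0 integral_nonneg_eq_0_iff_AE[OF L2] by simp
  then have "?S \<in> null_sets lborel"
    using op by (auto simp: AE_iff_null_sets)
  then have "negligible ?S"
    by (simp add: negligible_iff_null_sets null_sets_completionI)
  then have "?S = {}" using open_not_negligible[OF op] by blast
  then show ?thesis by auto
qed

text \<open>
  Each annihilation operator lowers the eigenvalue by \<open>2\<close> and preserves \<open>L\<^sup>2\<close>, while below \<open>d\<close>
  there is no eigenvalue.
\<close>

lemma annihilations_vanish: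
  fixes u :: "real^'n::finite \<Rightarrow> real"
  assumes "smooth u" "harmonic_oscillator u = (\<lambda>x. lam * u x)"
    "integrable lborel (\<lambda>x. (u x)\<^sup>2)" "lam - CARD('n) < 2 * real m" "length js = m"
  shows "foldr annihilation js u = (\<lambda>_. 0)"
  using assms
proof (induction m arbitrary: u lam js)
  case 0
  let ?M = "\<integral>x. (u x)\<^sup>2 \<partial>lborel"
  have "?M \<ge> 0" by (intro integral_nonneg_AE) auto
  moreover have "0 \<le> (lam - CARD('n)) * ?M" using energy_estimate(2)[OF 0(1-3)] .
  then have "?M \<le> 0" using 0(4) by (simp add: zero_le_mult_iff)
  ultimately have "?M = 0" by linarith
  then show ?case
    using continuous_integral_square_eq_0[OF smooth_continuous[OF 0(1)] 0(3)] 0(5) by simp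
next
  case (Suc m)
  obtain ks j where js: "js = ks @ [j]" using Suc.prems(5) by (cases js rule: rev_cases) auto
  have "foldr annihilation ks (annihilation j u) = (\<lambda>_. 0)"
    by (rule Suc.IH[OF smooth_annihilation[OF Suc.prems(1)]
          harmonic_oscillator_annihilation[OF Suc.prems(1,2)] energy_estimate(1)[OF Suc.prems(1-3)]])
      (use Suc.prems js in auto)
  then show ?case by (simp add: js)
qed

text \<open>Mean value theorem on the segment from \<open>0\<close> to \<open>x\<close>; the factor \<open>|x|\<close> is at most \<open>exp |x|\<close>.\<close>

lemma gaussian_growth_0_of_partials:
  fixes p :: "real^'n::finite \<Rightarrow> real"
  assumes d: "\<And>x. p differentiable at x" and g: "\<And>j. gaussian_growth 0 (partial j p)"
  shows "gaussian_growth 0 p"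
proof -
  have abs: "gaussian_growth 0 (\<lambda>x. \<bar>partial j p x\<bar>)" for j
    using g[of j] by (simp add: gaussian_growth_def)
  have "gaussian_growth 0 (\<lambda>x. \<Sum>j\<in>J. \<bar>partial j p x\<bar>)" if "finite J" for J
    using that
  proof induction
    case empty
    show ?case by (rule gaussian_growthI[of _ 0]) simp
  next
    case (insert j J)
    then show ?case using gaussian_growth_add[OF abs[of j]] by simp
  qed
  then obtain C s where C: "\<And>x. \<bar>\<Sum>j\<in>UNIV. \<bar>partial j p x\<bar>\<bar> \<le> C * exp (s * norm x - 0 / 2 * (norm x)\<^sup>2)"
    unfolding gaussian_growth_def by (metis finite)
  have "C \<ge> 0" using order_trans[OF abs_ge_zero C[of 0]] by simp
  show ?thesis
  proof (rule gaussian_growthI)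
    fix x :: "real^'n"
    have "((\<lambda>t. p (t *\<^sub>R x)) has_real_derivative frechet_derivative p (at (t *\<^sub>R x)) x) (at t)" for t
    proof -
      have D: "(p has_derivative frechet_derivative p (at (t *\<^sub>R x))) (at (t *\<^sub>R x))"
        using d by (simp add: frechet_derivative_works[symmetric])
      have "((\<lambda>t. p (t *\<^sub>R x)) has_derivative (\<lambda>h. frechet_derivative p (at (t *\<^sub>R x)) (h *\<^sub>R x))) (at t)"
        by (rule has_derivative_compose[where g = p and f = "\<lambda>t. t *\<^sub>R x"])
          (auto intro!: derivative_eq_intros D)
      then show ?thesis
        using linear_scale[OF has_derivative_linear[OF D]]
        by (simp add: has_field_derivative_def mult.commute[of _ "frechet_derivative p _ _"])
    qed
    from MVT2[of 0 1, OF _ this] obtain t where t: "0 < t" "t < 1"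
      "p x - p 0 = frechet_derivative p (at (t *\<^sub>R x)) x" by auto
    have lin: "linear (frechet_derivative p (at (t *\<^sub>R x)))"
      by (rule linear_frechet_derivative[OF d])
    have "x = (\<Sum>j\<in>UNIV. x $ j *\<^sub>R axis j 1)"
      using basis_expansion[of x] by (simp add: scalar_mult_eq_scaleR)
    then have "frechet_derivative p (at (t *\<^sub>R x)) x
        = frechet_derivative p (at (t *\<^sub>R x)) (\<Sum>j\<in>UNIV. x $ j *\<^sub>R axis j 1)" by simp
    also have "\<dots> = (\<Sum>j\<in>UNIV. x $ j * partial j p (t *\<^sub>R x))"
      by (simp add: linear_sum[OF lin] linear_scale[OF lin] partial_def)
    also have "\<bar>\<dots>\<bar> \<le> (\<Sum>j\<in>UNIV. \<bar>x $ j * partial j p (t *\<^sub>R x)\<bar>)" by (rule sum_abs)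
    also have "\<dots> \<le> (\<Sum>j\<in>UNIV. norm x * \<bar>partial j p (t *\<^sub>R x)\<bar>)"
      unfolding abs_mult by (intro sum_mono mult_right_mono component_le_norm_cart) auto
    also have "\<dots> \<le> norm x * (C * exp (\<bar>s\<bar> * norm x))"
    proof -
      have "s * norm (t *\<^sub>R x) \<le> \<bar>s\<bar> * norm x"
        using t mult_left_le_one_le[of "norm x" t] by (intro mult_mono) auto
      then have "C * exp (s * norm (t *\<^sub>R x)) \<le> C * exp (\<bar>s\<bar> * norm x)"
        using \<open>C \<ge> 0\<close> by (intro mult_left_mono) auto
      then have "(\<Sum>j\<in>UNIV. \<bar>partial j p (t *\<^sub>R x)\<bar>) \<le> C * exp (\<bar>s\<bar> * norm x)"
        using C[of "t *\<^sub>R x"] by simp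
      then show ?thesis unfolding sum_distrib_left[symmetric] by (intro mult_left_mono) auto
    qed
    also have "norm x * (C * exp (\<bar>s\<bar> * norm x)) \<le> exp (norm x) * (C * exp (\<bar>s\<bar> * norm x))"
    proof (rule mult_right_mono)
      show "norm x \<le> exp (norm x)" using exp_ge_add_one_self[of "norm x"] by linarith
    qed (use \<open>C \<ge> 0\<close> in simp)
    also have "\<dots> = C * exp ((\<bar>s\<bar> + 1) * norm x)"
      by (simp add: distrib_right exp_add)
    finally have "\<bar>p x - p 0\<bar> \<le> C * exp ((\<bar>s\<bar> + 1) * norm x)" using t(3) by simp
    moreover have "\<bar>p 0\<bar> \<le> \<bar>p 0\<bar> * exp ((\<bar>s\<bar> + 1) * norm x)"
      using mult_left_mono[of 1 "exp ((\<bar>s\<bar> + 1) * norm x)" "\<bar>p 0\<bar>"] by simp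
    ultimately have "\<bar>p x\<bar> \<le> (\<bar>p 0\<bar> + C) * exp ((\<bar>s\<bar> + 1) * norm x)"
      unfolding distrib_right by linarith
    then show "\<bar>p x\<bar> \<le> (\<bar>p 0\<bar> + C) * exp ((\<bar>s\<bar> + 1) * norm x - 0 / 2 * (norm x)\<^sup>2)" by simp
  qed
qed

text \<open>
  Such a function is a polynomial of degree below \<open>m\<close>. The growth bound climbs from the
  derivatives of order \<open>m\<close> down to the function itself, one order at a time.
\<close>

lemma gauss_0_of_vanishing_partials:
  assumes "smooth p" "\<And>js. length js = m \<Longrightarrow> foldr partial js p = (\<lambda>_. 0)"
  shows "gauss 0 p"
  using assms
proof (induction m arbitrary: p)
  case 0
  from 0(2)[of "[]"] have "p = (\<lambda>_. 0)" by simp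
  then show ?case by (simp add: gauss_const)
next
  case (Suc m)
  have "gauss 0 (partial j p)" for j
  proof (rule Suc.IH)
    show "foldr partial js (partial j p) = (\<lambda>_. 0)" if "length js = m" for js
      using Suc.prems(2)[of "js @ [j]"] that by simp
  qed (rule smooth_partial[OF Suc.prems(1)])
  note g = this
  show ?case
    by (rule smooth_with_partialI[OF smooth_differentiable[OF Suc.prems(1)]
        gaussian_growth_0_of_partials[OF smooth_differentiable[OF Suc.prems(1)] smooth_with_bound[OF g]] g])
qed

text \<open>
  Conjugation by the Gaussian turns annihilation operators into partial derivatives, so all
  derivatives of high order of \<open>e exp (|x|\<^sup>2 / 2)\<close> vanish.
\<close>

theorem eigenfunction_gauss:
  fixes e :: "real^'n::finite \<Rightarrow> real"
  assumes "eigenfunction e lam"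
  shows "gauss 1 e"
proof -
  have e: "smooth e" "harmonic_oscillator e = (\<lambda>x. lam * e x)" "integrable lborel (\<lambda>x. (e x)\<^sup>2)"
    using assms by (auto simp: eigenfunction_def)
  define G where "G = (\<lambda>x::real^'n. exp (- (- 1) / 2 * (norm x)\<^sup>2))"
  have G: "smooth G" unfolding G_def by (rule smooth_with_smooth[OF gauss_gaussian])
  have dG: "partial j G = (\<lambda>x. x $ j * G x)" for j
    unfolding G_def partial_gaussian by simp
  define p where "p x = e x * G x" for x
  have "smooth p" unfolding p_def by (intro smooth_mult e G)
  have step: "partial j (\<lambda>x. u x * G x) = (\<lambda>x. annihilation j u x * G x)" if "smooth u" for j u
    using that by (simp add: partial_mult smooth_differentiable G dG annihilation_def algebra_simps)
  have iter: "smooth (foldr annihilation js e) \<and>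
      foldr partial js p = (\<lambda>x. foldr annihilation js e x * G x)" for js
    by (induction js) (simp_all add: p_def e step smooth_annihilation)
  obtain m :: nat where m: "(lam - CARD('n)) / 2 < real m" using reals_Archimedean2 by blast
  have "gauss 0 p"
  proof (rule gauss_0_of_vanishing_partials[OF \<open>smooth p\<close>])
    fix js :: "'n list" assume "length js = m"
    then have "foldr annihilation js e = (\<lambda>_. 0)"
      using m by (intro annihilations_vanish[OF e]) auto
    then show "foldr partial js p = (\<lambda>_. 0)" using iter[of js] by simp
  qed
  from gauss_mult[OF this gauss_gaussian[of 1]]
  have "gauss 1 (\<lambda>x. p x * exp (- 1 / 2 * (norm x)\<^sup>2))" by simp
  moreover have "p x * exp (- 1 / 2 * (norm x)\<^sup>2) = e x" for x
    by (simp add: p_def G_def mult.assoc exp_add[symmetric])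
  ultimately show ?thesis by simp
qed

section \<open>One integration by parts on tensor terms\<close>

fun flip :: "letter \<Rightarrow> letter" where
  "flip Nabla = Pos"
| "flip Pos = Nabla"

text \<open>The commutator of \<open>H\<close> with \<open>P(\<alpha>)\<close> is \<open>-2\<close> times the sum of \<open>P(\<beta>)\<close> over these words.\<close>

fun flips :: "(letter \<times> nat) list \<Rightarrow> (letter \<times> nat) list list" where
  "flips [] = []"
| "flips ((a, i) # \<alpha>) = ((flip a, i) # \<alpha>) # map ((#) (a, i)) (flips \<alpha>)"

lemma map_snd_flips: "\<beta> \<in> set (flips \<alpha>) \<Longrightarrow> map snd \<beta> = map snd \<alpha>"
  by (induction \<alpha> arbitrary: \<beta> rule: flips.induct) auto

lemma length_flips: "\<beta> \<in> set (flips \<alpha>) \<Longrightarrow> length \<beta> = length \<alpha>"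
  by (metis length_map map_snd_flips)

lemma P_comp_Nil [simp]: "P_comp \<iota> [] u = u"
  by (simp add: P_comp_def)

lemma P_comp_Cons [simp]: "P_comp \<iota> ((a, i) # \<alpha>) u = comp1 a (\<iota> i) (P_comp \<iota> \<alpha> u)"
  by (simp add: P_comp_def)

lemma P_comp_fun_upd:
  "n \<notin> set (map snd \<alpha>) \<Longrightarrow> P_comp (\<iota>(n := j)) \<alpha> u = P_comp \<iota> \<alpha> u"
  by (induction \<alpha>) auto

lemma smooth_comp1: "smooth u \<Longrightarrow> smooth (comp1 a j u)"
  by (cases a) (auto intro!: smooth_intros)

lemma smooth_P_comp: "smooth u \<Longrightarrow> smooth (P_comp \<iota> \<alpha> u)"
  by (induction \<alpha>) (auto intro: smooth_comp1)

lemma gauss_comp1: "gauss c u \<Longrightarrow> gauss c (comp1 a j u)"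
  by (cases a) (auto intro: smooth_with_partial gauss_coord_mult)

lemma gauss_P_comp: "gauss c u \<Longrightarrow> gauss c (P_comp \<iota> \<alpha> u)"
  by (induction \<alpha>) (auto intro: gauss_comp1)

lemma comp1_add:
  "smooth u \<Longrightarrow> smooth v \<Longrightarrow> comp1 a j (\<lambda>x. u x + v x) = (\<lambda>x. comp1 a j u x + comp1 a j v x)"
  by (cases a) (auto simp: partial_add smooth_differentiable algebra_simps)

lemma comp1_cmult:
  "smooth u \<Longrightarrow> comp1 a j (\<lambda>x. c * u x) = (\<lambda>x. c * comp1 a j u x)"
  by (cases a) (auto simp: partial_cmult smooth_differentiable)

lemma smooth_sum_list: "(\<And>b. b \<in> set bs \<Longrightarrow> smooth (f b)) \<Longrightarrow> smooth (\<lambda>x. \<Sum>b\<leftarrow>bs. f b x)"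
proof (induction bs)
  case Nil
  show ?case using smooth_const[of 0] by simp
next
  case (Cons b bs)
  then show ?case using smooth_add[of "f b" "\<lambda>x. \<Sum>b\<leftarrow>bs. f b x"] by simp
qed

lemma comp1_sum_list:
  "(\<And>b. b \<in> set bs \<Longrightarrow> smooth (f b)) \<Longrightarrow>
    comp1 a j (\<lambda>x. \<Sum>b\<leftarrow>bs. f b x) = (\<lambda>x. \<Sum>b\<leftarrow>bs. comp1 a j (f b) x)"
proof (induction bs)
  case Nil
  show ?case by (cases a) (simp_all add: partial_const)
next
  case (Cons b bs)
  have "comp1 a j (\<lambda>x. f b x + (\<Sum>b\<leftarrow>bs. f b x)) = (\<lambda>x. comp1 a j (f b) x + comp1 a j (\<lambda>x. \<Sum>b\<leftarrow>bs. f b x) x)"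
    using Cons.prems by (intro comp1_add smooth_sum_list) auto
  then show ?case using Cons by simp
qed

lemma harmonic_oscillator_comp1:
  assumes "smooth u"
  shows "harmonic_oscillator (comp1 a j u)
    = (\<lambda>x. comp1 a j (harmonic_oscillator u) x + (- 2) * comp1 (flip a) j u x)"
proof (cases a)
  case Nabla
  then show ?thesis using harmonic_oscillator_partial[OF assms, of j] by (simp only: comp1.simps flip.simps)
next
  case Pos
  then show ?thesis using harmonic_oscillator_coord_mult[OF assms, of j] by (simp only: comp1.simps flip.simps)
qed

lemma harmonic_oscillator_P_comp:
  assumes u: "smooth u" and H: "harmonic_oscillator u = (\<lambda>x. lam * u x)"
  shows "harmonic_oscillator (P_comp \<iota> \<alpha> u)
    = (\<lambda>x. lam * P_comp \<iota> \<alpha> u x + (- 2) * (\<Sum>\<beta>\<leftarrow>flips \<alpha>. P_comp \<iota> \<beta> u x))"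
proof (induction \<alpha>)
  case Nil
  show ?case by (simp add: H)
next
  case (Cons l \<alpha>)
  obtain a i where l: "l = (a, i)" by fastforce
  let ?w = "P_comp \<iota> \<alpha> u" and ?s = "\<lambda>x. \<Sum>\<beta>\<leftarrow>flips \<alpha>. P_comp \<iota> \<beta> u x"
  have s: "smooth ?w" "smooth ?s" by (auto intro!: smooth_P_comp u smooth_sum_list)
  have "comp1 a (\<iota> i) (harmonic_oscillator ?w)
      = (\<lambda>x. lam * comp1 a (\<iota> i) ?w x + (- 2) * comp1 a (\<iota> i) ?s x)"
    unfolding Cons.IH by (simp only: comp1_add comp1_cmult smooth_cmult s)
  also have "comp1 a (\<iota> i) ?s = (\<lambda>x. \<Sum>\<beta>\<leftarrow>flips \<alpha>. comp1 a (\<iota> i) (P_comp \<iota> \<beta> u) x)"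
    by (rule comp1_sum_list) (rule smooth_P_comp[OF u])
  finally show ?case
    unfolding l P_comp_Cons harmonic_oscillator_comp1[OF s(1)] by (simp add: o_def algebra_simps)
qed

text \<open>
  The terms produced from one term by an integration by parts: those of the three commutators, and
  the four in which \<open>H\<close> fails to be a derivation. The latter contract a new index, which exceeds all
  indices in use.
\<close>

definition successors ::
    "(letter \<times> nat) list \<times> (letter \<times> nat) list \<times> (letter \<times> nat) list \<Rightarrow>
     ((letter \<times> nat) list \<times> (letter \<times> nat) list \<times> (letter \<times> nat) list) list" where
  "successors = (\<lambda>(\<alpha>, \<beta>, \<gamma>). let n = Suc (sum_list (indices (\<alpha>, \<beta>, \<gamma>))) in
     map (\<lambda>\<alpha>'. (\<alpha>', \<beta>, \<gamma>)) (flips \<alpha>) @ map (\<lambda>\<beta>'. (\<alpha>, \<beta>', \<gamma>)) (flips \<beta>) @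
     map (\<lambda>\<gamma>'. (\<alpha>, \<beta>, \<gamma>')) (flips \<gamma>) @
     [((Nabla, n) # \<alpha>, (Nabla, n) # \<beta>, \<gamma>), ((Nabla, n) # \<alpha>, \<beta>, (Nabla, n) # \<gamma>),
      (\<alpha>, (Nabla, n) # \<beta>, (Nabla, n) # \<gamma>), ((Pos, n) # \<alpha>, (Pos, n) # \<beta>, \<gamma>)])"

lemma fresh_index: "Suc (sum_list is) \<notin> set is"
  using member_le_sum_list[of "Suc (sum_list is)" "is"] by auto

lemma successors_tensor_terms:
  assumes t: "t \<in> tensor_terms k" and t': "t' \<in> set (successors t)"
  shows "t' \<in> tensor_terms (Suc k)"
proof -
  obtain \<alpha> \<beta> \<gamma> where tt: "t = (\<alpha>, \<beta>, \<gamma>)" by (cases t) auto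
  define n where "n = Suc (sum_list (indices (\<alpha>, \<beta>, \<gamma>)))"
  have n: "n \<notin> set (indices (\<alpha>, \<beta>, \<gamma>))" unfolding n_def by (rule fresh_index)
  have ok: "orders_ok k (\<alpha>, \<beta>, \<gamma>)"
    and cnt: "\<And>i. i \<in> set (indices (\<alpha>, \<beta>, \<gamma>)) \<Longrightarrow> count_list (indices (\<alpha>, \<beta>, \<gamma>)) i = 2"
    using t unfolding tensor_terms_def tt by auto
  from t' consider
      \<alpha>' where "\<alpha>' \<in> set (flips \<alpha>)" "t' = (\<alpha>', \<beta>, \<gamma>)"
    | \<beta>' where "\<beta>' \<in> set (flips \<beta>)" "t' = (\<alpha>, \<beta>', \<gamma>)"
    | \<gamma>' where "\<gamma>' \<in> set (flips \<gamma>)" "t' = (\<alpha>, \<beta>, \<gamma>')"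
    | a where "t' = ((a, n) # \<alpha>, (a, n) # \<beta>, \<gamma>)"
    | "t' = ((Nabla, n) # \<alpha>, \<beta>, (Nabla, n) # \<gamma>)"
    | "t' = (\<alpha>, (Nabla, n) # \<beta>, (Nabla, n) # \<gamma>)"
    by (auto simp: successors_def tt Let_def n_def)
  then have "orders_ok (Suc k) t' \<and>
    (\<forall>i\<in>set (indices t'). count_list (indices t') i = 2)"
  proof cases
    case 1
    then show ?thesis using ok cnt map_snd_flips[OF 1(1)] length_flips[OF 1(1)]
      by (simp add: orders_ok_def indices_def)
  next
    case 2
    then show ?thesis using ok cnt map_snd_flips[OF 2(1)] length_flips[OF 2(1)]
      by (simp add: orders_ok_def indices_def)
  next
    case 3
    then show ?thesis using ok cnt map_snd_flips[OF 3(1)] length_flips[OF 3(1)]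
      by (simp add: orders_ok_def indices_def)
  qed (use ok cnt n in \<open>auto simp: orders_ok_def indices_def count_list_0_iff\<close>)
  then show ?thesis by (simp add: tensor_terms_def)
qed

lemma sum_PiE_insert:
  fixes f :: "('i \<Rightarrow> 'n::finite) \<Rightarrow> real"
  assumes "n \<notin> I"
  shows "(\<Sum>\<iota>\<in>insert n I \<rightarrow>\<^sub>E UNIV. f \<iota>) = (\<Sum>\<iota>\<in>I \<rightarrow>\<^sub>E UNIV. \<Sum>j\<in>UNIV. f (\<iota>(n := j)))"
proof -
  have "(\<Sum>\<iota>\<in>insert n I \<rightarrow>\<^sub>E UNIV. f \<iota>) = (\<Sum>(j, \<iota>)\<in>UNIV \<times> (I \<rightarrow>\<^sub>E UNIV). f (\<iota>(n := j)))"
    unfolding PiE_insert_eq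
    by (subst sum.reindex[OF inj_combinator[OF assms]]) (simp add: case_prod_unfold)
  also have "\<dots> = (\<Sum>j\<in>UNIV. \<Sum>\<iota>\<in>I \<rightarrow>\<^sub>E UNIV. f (\<iota>(n := j)))"
    by (rule sum.cartesian_product[symmetric])
  also have "\<dots> = (\<Sum>\<iota>\<in>I \<rightarrow>\<^sub>E UNIV. \<Sum>j\<in>UNIV. f (\<iota>(n := j)))"
    by (rule sum.swap)
  finally show ?thesis .
qed

lemma gauss_tensor_term:
  "gauss a u \<Longrightarrow> gauss b v \<Longrightarrow> gauss c w \<Longrightarrow> gauss (a + b + c) (tensor_term t u v w)"
  by (cases t) (auto simp: tensor_term_def intro!: gauss_sum gauss_mult gauss_P_comp)

lemma harmonic_oscillator_sum:
  assumes "finite I" "\<And>i. i \<in> I \<Longrightarrow> smooth (u i)"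
  shows "harmonic_oscillator (\<lambda>x. \<Sum>i\<in>I. u i x) = (\<lambda>x. \<Sum>i\<in>I. harmonic_oscillator (u i) x)"
  using assms
proof (induction I)
  case empty
  show ?case using harmonic_oscillator_cmult[OF smooth_const, of 0 0] by simp
next
  case (insert i I)
  then show ?case using harmonic_oscillator_add[OF _ smooth_sum[of I u], of "u i"] by simp
qed

lemma sum_sum_list_swap: "(\<Sum>i\<in>I. \<Sum>b\<leftarrow>bs. f i b) = (\<Sum>b\<leftarrow>bs. \<Sum>i\<in>I. f i b :: real)"
  by (induction bs) (simp_all add: sum.distrib)

lemma harmonic_oscillator_tensor_term:
  fixes u v w :: "real^'n::finite \<Rightarrow> real"
  assumes s: "smooth u" "smooth v" "smooth w"
    and H: "harmonic_oscillator u = (\<lambda>x. l2 * u x)" "harmonic_oscillator v = (\<lambda>x. l3 * v x)"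
      "harmonic_oscillator w = (\<lambda>x. l4 * w x)"
  shows "harmonic_oscillator (tensor_term t u v w) x
    = (l2 + l3 + l4) * tensor_term t u v w x - 2 * (\<Sum>t'\<leftarrow>successors t. tensor_term t' u v w x)"
proof -
  obtain \<alpha> \<beta> \<gamma> where t: "t = (\<alpha>, \<beta>, \<gamma>)" by (cases t) auto
  define n where "n = Suc (sum_list (indices (\<alpha>, \<beta>, \<gamma>)))"
  define I where "I = set (indices (\<alpha>, \<beta>, \<gamma>))"
  have "n \<notin> I" unfolding n_def I_def by (rule fresh_index)
  then have n: "n \<notin> set (map snd \<alpha>)" "n \<notin> set (map snd \<beta>)" "n \<notin> set (map snd \<gamma>)"
    by (auto simp: I_def indices_def)
  define a where "a \<iota> = P_comp \<iota> \<alpha> u" for \<iota>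
  define b where "b \<iota> = P_comp \<iota> \<beta> v" for \<iota>
  define c where "c \<iota> = P_comp \<iota> \<gamma> w" for \<iota>
  have sabc: "smooth (a \<iota>)" "smooth (b \<iota>)" "smooth (c \<iota>)" for \<iota>
    unfolding a_def b_def c_def by (intro smooth_P_comp s)+
  have T: "tensor_term t u v w = (\<lambda>x. \<Sum>\<iota>\<in>I \<rightarrow>\<^sub>E UNIV. a \<iota> x * b \<iota> x * c \<iota> x)"
    by (simp add: tensor_term_def t I_def a_def b_def c_def)
  have fin: "finite (I \<rightarrow>\<^sub>E (UNIV :: 'n set))" by (simp add: I_def finite_PiE)
  have fa: "(\<Sum>\<alpha>'\<leftarrow>flips \<alpha>. tensor_term (\<alpha>', \<beta>, \<gamma>) u v w x)
      = (\<Sum>\<iota>\<in>I \<rightarrow>\<^sub>E UNIV. (\<Sum>\<alpha>'\<leftarrow>flips \<alpha>. P_comp \<iota> \<alpha>' u x) * b \<iota> x * c \<iota> x)"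
  proof -
    have "tensor_term (\<alpha>', \<beta>, \<gamma>) u v w x = (\<Sum>\<iota>\<in>I \<rightarrow>\<^sub>E UNIV. P_comp \<iota> \<alpha>' u x * b \<iota> x * c \<iota> x)"
      if "\<alpha>' \<in> set (flips \<alpha>)" for \<alpha>'
      using map_snd_flips[OF that] by (simp add: tensor_term_def I_def indices_def b_def c_def flip: set_map)
    then show ?thesis
      by (simp add: sum_sum_list_swap sum_list_mult_const[symmetric] cong: map_cong)
  qed
  have fb: "(\<Sum>\<beta>'\<leftarrow>flips \<beta>. tensor_term (\<alpha>, \<beta>', \<gamma>) u v w x)
      = (\<Sum>\<iota>\<in>I \<rightarrow>\<^sub>E UNIV. a \<iota> x * (\<Sum>\<beta>'\<leftarrow>flips \<beta>. P_comp \<iota> \<beta>' v x) * c \<iota> x)"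
  proof -
    have "tensor_term (\<alpha>, \<beta>', \<gamma>) u v w x = (\<Sum>\<iota>\<in>I \<rightarrow>\<^sub>E UNIV. a \<iota> x * P_comp \<iota> \<beta>' v x * c \<iota> x)"
      if "\<beta>' \<in> set (flips \<beta>)" for \<beta>'
      using map_snd_flips[OF that] by (simp add: tensor_term_def I_def indices_def a_def c_def flip: set_map)
    then show ?thesis
      by (simp add: sum_sum_list_swap sum_list_mult_const[symmetric] sum_list_const_mult[symmetric] cong: map_cong)
  qed
  have fc: "(\<Sum>\<gamma>'\<leftarrow>flips \<gamma>. tensor_term (\<alpha>, \<beta>, \<gamma>') u v w x)
      = (\<Sum>\<iota>\<in>I \<rightarrow>\<^sub>E UNIV. a \<iota> x * b \<iota> x * (\<Sum>\<gamma>'\<leftarrow>flips \<gamma>. P_comp \<iota> \<gamma>' w x))"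
  proof -
    have "tensor_term (\<alpha>, \<beta>, \<gamma>') u v w x = (\<Sum>\<iota>\<in>I \<rightarrow>\<^sub>E UNIV. a \<iota> x * b \<iota> x * P_comp \<iota> \<gamma>' w x)"
      if "\<gamma>' \<in> set (flips \<gamma>)" for \<gamma>'
      using map_snd_flips[OF that] by (simp add: tensor_term_def I_def indices_def a_def b_def flip: set_map)
    then show ?thesis
      by (simp add: sum_sum_list_swap sum_list_const_mult[symmetric] cong: map_cong)
  qed
  note upd = P_comp_fun_upd[OF n(1)] P_comp_fun_upd[OF n(2)] P_comp_fun_upd[OF n(3)]
  have new: "tensor_term ((l, n) # \<alpha>, (l, n) # \<beta>, \<gamma>) u v w x
        = (\<Sum>\<iota>\<in>I \<rightarrow>\<^sub>E UNIV. \<Sum>j\<in>UNIV. comp1 l j (a \<iota>) x * comp1 l j (b \<iota>) x * c \<iota> x)"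
    "tensor_term ((l, n) # \<alpha>, \<beta>, (l, n) # \<gamma>) u v w x
        = (\<Sum>\<iota>\<in>I \<rightarrow>\<^sub>E UNIV. \<Sum>j\<in>UNIV. comp1 l j (a \<iota>) x * b \<iota> x * comp1 l j (c \<iota>) x)"
    "tensor_term (\<alpha>, (l, n) # \<beta>, (l, n) # \<gamma>) u v w x
        = (\<Sum>\<iota>\<in>I \<rightarrow>\<^sub>E UNIV. \<Sum>j\<in>UNIV. a \<iota> x * comp1 l j (b \<iota>) x * comp1 l j (c \<iota>) x)" for l
  proof -
    have "set (indices ((l, n) # \<alpha>, (l, n) # \<beta>, \<gamma>)) = insert n I"
      "set (indices ((l, n) # \<alpha>, \<beta>, (l, n) # \<gamma>)) = insert n I"
      "set (indices (\<alpha>, (l, n) # \<beta>, (l, n) # \<gamma>)) = insert n I"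
      by (auto simp: I_def indices_def)
    then show "tensor_term ((l, n) # \<alpha>, (l, n) # \<beta>, \<gamma>) u v w x
        = (\<Sum>\<iota>\<in>I \<rightarrow>\<^sub>E UNIV. \<Sum>j\<in>UNIV. comp1 l j (a \<iota>) x * comp1 l j (b \<iota>) x * c \<iota> x)"
      "tensor_term ((l, n) # \<alpha>, \<beta>, (l, n) # \<gamma>) u v w x
        = (\<Sum>\<iota>\<in>I \<rightarrow>\<^sub>E UNIV. \<Sum>j\<in>UNIV. comp1 l j (a \<iota>) x * b \<iota> x * comp1 l j (c \<iota>) x)"
      "tensor_term (\<alpha>, (l, n) # \<beta>, (l, n) # \<gamma>) u v w x
        = (\<Sum>\<iota>\<in>I \<rightarrow>\<^sub>E UNIV. \<Sum>j\<in>UNIV. a \<iota> x * comp1 l j (b \<iota>) x * comp1 l j (c \<iota>) x)"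
      by (simp_all add: tensor_term_def sum_PiE_insert[OF \<open>n \<notin> I\<close>] upd a_def b_def c_def)
  qed
  have each: "harmonic_oscillator (\<lambda>x. a \<iota> x * b \<iota> x * c \<iota> x) x
      = (l2 + l3 + l4) * (a \<iota> x * b \<iota> x * c \<iota> x)
      - 2 * ((\<Sum>\<alpha>'\<leftarrow>flips \<alpha>. P_comp \<iota> \<alpha>' u x) * b \<iota> x * c \<iota> x
        + a \<iota> x * (\<Sum>\<beta>'\<leftarrow>flips \<beta>. P_comp \<iota> \<beta>' v x) * c \<iota> x
        + a \<iota> x * b \<iota> x * (\<Sum>\<gamma>'\<leftarrow>flips \<gamma>. P_comp \<iota> \<gamma>' w x)
        + (\<Sum>j\<in>UNIV. comp1 Nabla j (a \<iota>) x * comp1 Nabla j (b \<iota>) x * c \<iota> x)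
        + (\<Sum>j\<in>UNIV. comp1 Nabla j (a \<iota>) x * b \<iota> x * comp1 Nabla j (c \<iota>) x)
        + (\<Sum>j\<in>UNIV. a \<iota> x * comp1 Nabla j (b \<iota>) x * comp1 Nabla j (c \<iota>) x)
        + (\<Sum>j\<in>UNIV. comp1 Pos j (a \<iota>) x * comp1 Pos j (b \<iota>) x * c \<iota> x))" for \<iota>
  proof -
    have "harmonic_oscillator (a \<iota>) x = l2 * a \<iota> x - 2 * (\<Sum>\<alpha>'\<leftarrow>flips \<alpha>. P_comp \<iota> \<alpha>' u x)"
      "harmonic_oscillator (b \<iota>) x = l3 * b \<iota> x - 2 * (\<Sum>\<beta>'\<leftarrow>flips \<beta>. P_comp \<iota> \<beta>' v x)"
      "harmonic_oscillator (c \<iota>) x = l4 * c \<iota> x - 2 * (\<Sum>\<gamma>'\<leftarrow>flips \<gamma>. P_comp \<iota> \<gamma>' w x)"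
      by (simp_all add: a_def b_def c_def harmonic_oscillator_P_comp[OF s(1) H(1)]
          harmonic_oscillator_P_comp[OF s(2) H(2)] harmonic_oscillator_P_comp[OF s(3) H(3)])
    note eqs = this
    show ?thesis
      unfolding harmonic_oscillator_mult3[OF sabc] eqs comp1.simps
      by (simp only: sum.distrib algebra_simps)
  qed
  have "harmonic_oscillator (tensor_term t u v w) x
      = (\<Sum>\<iota>\<in>I \<rightarrow>\<^sub>E UNIV. harmonic_oscillator (\<lambda>x. a \<iota> x * b \<iota> x * c \<iota> x) x)"
    unfolding T by (subst harmonic_oscillator_sum[OF fin]) (intro smooth_mult sabc, rule refl)
  also have "\<dots> = (l2 + l3 + l4) * tensor_term t u v w x - 2 * (\<Sum>t'\<leftarrow>successors t. tensor_term t' u v w x)"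
    unfolding each t successors_def
    by (simp add: Let_def n_def[symmetric] o_def fa fb fc new sum.distrib sum_subtractf
        sum_distrib_left[symmetric] T[unfolded t])
  finally show ?thesis .
qed

section \<open>Tensor terms that are products \<open>P(\<alpha>)e\<^sub>2 P(\<beta>)e\<^sub>3 P(\<gamma>)e\<^sub>4\<close>\<close>

definition forget_indices ::
    "(letter \<times> nat) list \<times> (letter \<times> nat) list \<times> (letter \<times> nat) list
      \<Rightarrow> letter list \<times> letter list \<times> letter list" where
  "forget_indices = (\<lambda>(\<alpha>, \<beta>, \<gamma>). (map fst \<alpha>, map fst \<beta>, map fst \<gamma>))"

lemma even_length_indices:
  assumes "t \<in> tensor_terms k"
  shows "even (length (indices t))"
proof -
  have "length (indices t) = (\<Sum>i\<in>set (indices t). count_list (indices t) i)"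
    by (rule sum_count_set[symmetric]) auto
  also have "\<dots> = 2 * card (set (indices t))"
    using assms by (simp add: tensor_terms_def)
  finally show ?thesis by simp
qed

lemma forget_indices_P_terms:
  "t \<in> tensor_terms k \<Longrightarrow> forget_indices t \<in> P_terms k"
  using even_length_indices[of t k]
  by (auto simp: tensor_terms_def P_terms_def orders_ok_def forget_indices_def indices_def)

lemma P1_Scal: "P1 a (Scal u) = Vec (\<lambda>x. \<chi> j. comp1 a j u x)"
  by (cases a) (auto simp: gradient_def vec_eq_iff fun_eq_iff)

lemma sum_PiE_singleton:
  fixes f :: "('i \<Rightarrow> 'n::finite) \<Rightarrow> real"
  shows "(\<Sum>\<iota>\<in>{i} \<rightarrow>\<^sub>E UNIV. f \<iota>) = (\<Sum>j\<in>UNIV. f ((\<lambda>_. undefined)(i := j)))"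
  using sum_PiE_insert[of i "{}" f] by (simp add: fun_upd_def)

text \<open>
  With one letter in each of at most two factors, the only possible contraction is the scalar product
  of two vectors.
\<close>

lemma tensor_term_eq_P_term_order_1:
  assumes t: "t \<in> tensor_terms 1"
  shows "(tensor_term t :: 'n::finite trilinear) = P_term (forget_indices t)"
proof -
  obtain \<alpha> \<beta> \<gamma> where tt: "t = (\<alpha>, \<beta>, \<gamma>)" by (cases t) auto
  have le: "length \<alpha> \<le> 1" "length \<beta> \<le> 1" "length \<gamma> \<le> 1"
    and ev: "even (length \<alpha> + length \<beta> + length \<gamma>)" "length \<alpha> + length \<beta> + length \<gamma> \<le> 2"
    and cnt: "\<And>i. i \<in> set (indices t) \<Longrightarrow> count_list (indices t) i = 2"
    using t even_length_indices[OF t] by (auto simp: tensor_terms_def tt orders_ok_def indices_def)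
  have single: "\<delta> = [] \<or> (\<exists>a i. \<delta> = [(a, i)])" if "length \<delta> \<le> 1" for \<delta> :: "(letter \<times> nat) list"
    using that by (cases \<delta>) auto
  have pair: "i = i'" if "indices t = [i, i']" for i i'
    using cnt[of i] that by (simp split: if_splits)
  have ab: "i = i'" if "\<alpha> = [(a, i)]" "\<beta> = [(b, i')]" "\<gamma> = []" for a b i i'
    using that by (intro pair) (simp add: tt indices_def)
  have ac: "i = i'" if "\<alpha> = [(a, i)]" "\<beta> = []" "\<gamma> = [(b, i')]" for a b i i'
    using that by (intro pair) (simp add: tt indices_def)
  have bc: "i = i'" if "\<alpha> = []" "\<beta> = [(a, i)]" "\<gamma> = [(b, i')]" for a b i i'
    using that by (intro pair) (simp add: tt indices_def)
  consider "\<alpha> = []" "\<beta> = []" "\<gamma> = []"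
    | a b i where "\<alpha> = [(a, i)]" "\<beta> = [(b, i)]" "\<gamma> = []"
    | a b i where "\<alpha> = [(a, i)]" "\<beta> = []" "\<gamma> = [(b, i)]"
    | a b i where "\<alpha> = []" "\<beta> = [(a, i)]" "\<gamma> = [(b, i)]"
  proof -
    have "(\<alpha> = [] \<and> \<beta> = [] \<and> \<gamma> = []) \<or> (\<alpha> \<noteq> [] \<and> \<beta> \<noteq> [] \<and> \<gamma> = []) \<or> (\<alpha> \<noteq> [] \<and> \<beta> = [] \<and> \<gamma> \<noteq> [])
        \<or> (\<alpha> = [] \<and> \<beta> \<noteq> [] \<and> \<gamma> \<noteq> [])"
      using single[OF le(1)] single[OF le(2)] single[OF le(3)] ev by (elim disjE exE) simp_all
    then show ?thesis
      using that single[OF le(1)] single[OF le(2)] single[OF le(3)] ab ac bc by metis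
  qed
  then show ?thesis
    by cases (auto simp: fun_eq_iff tt tensor_term_def P_term_def forget_indices_def indices_def P_def
        P1_Scal sum_PiE_singleton inner_vec_def sum_distrib_left sum_distrib_right mult_ac)
qed

text \<open>In dimension one scalars and vectors have the same single component, whatever the indices.\<close>

lemma P_eq_P_comp_dim_1:
  fixes u :: "real^'n::finite \<Rightarrow> real"
  assumes U: "(UNIV :: 'n set) = {j0}"
  shows "P (map fst \<alpha>) u = (if even (length \<alpha>) then Scal (P_comp \<iota> \<alpha> u)
    else Vec (\<lambda>x. \<chi> j. P_comp \<iota> \<alpha> u x))"
proof (induction \<alpha>)
  case Nil
  show ?case by (simp add: P_def)
next
  case (Cons l \<alpha>)
  obtain a i where l: "l = (a, i)" by fastforce
  have j: "j = j0" for j :: 'n using U by auto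
  have "P (map fst (l # \<alpha>)) u = P1 a (P (map fst \<alpha>) u)" by (simp add: P_def l)
  also have "\<dots> = (if even (length (l # \<alpha>)) then Scal (P_comp \<iota> (l # \<alpha>) u)
    else Vec (\<lambda>x. \<chi> j. P_comp \<iota> (l # \<alpha>) u x))"
  proof (cases "even (length \<alpha>)")
    case True
    have "comp1 a j = comp1 a (\<iota> i)" for j
      using j[of j] j[of "\<iota> i"] by simp
    then have "(\<lambda>x. \<chi> j. comp1 a j (P_comp \<iota> \<alpha> u) x) = (\<lambda>x. \<chi> j. comp1 a (\<iota> i) (P_comp \<iota> \<alpha> u) x)"
      by (intro ext) (simp add: vec_eq_iff, metis)
    with True show ?thesis unfolding Cons.IH by (simp add: l P1_Scal)
  next
    case False
    with j[of "\<iota> i"] show ?thesis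
      unfolding Cons.IH by (cases a) (simp_all add: l divergence_def inner_vec_def U fun_eq_iff)
  qed
  finally show ?case .
qed

lemma tensor_term_eq_P_term_dim_1:
  assumes t: "t \<in> tensor_terms k" and card: "CARD('n::finite) = 1"
  shows "(tensor_term t :: 'n trilinear) = P_term (forget_indices t)"
proof (intro ext)
  fix u v w :: "real^'n \<Rightarrow> real" and x
  obtain \<alpha> \<beta> \<gamma> where tt: "t = (\<alpha>, \<beta>, \<gamma>)" by (cases t) auto
  have ev: "even (length \<alpha> + length \<beta> + length \<gamma>)"
    using even_length_indices[OF t] by (auto simp: tt indices_def)
  obtain j0 where U: "(UNIV :: 'n set) = {j0}" using card by (rule card_1_singletonE)
  define \<iota> where "\<iota> = restrict (\<lambda>_. j0) (set (indices t))"
  have "set (indices t) \<rightarrow>\<^sub>E (UNIV :: 'n set) = {\<iota>}"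
    unfolding U \<iota>_def using PiE_singleton[of "restrict (\<lambda>_. j0) (set (indices t))" "set (indices t)"]
    by (simp cong: PiE_cong)
  then have "tensor_term t u v w x = P_comp \<iota> \<alpha> u x * P_comp \<iota> \<beta> v x * P_comp \<iota> \<gamma> w x"
    by (simp add: tensor_term_def tt)
  then show "tensor_term t u v w x = P_term (forget_indices t) u v w x"
    using ev by (auto simp: tt P_term_def forget_indices_def P_eq_P_comp_dim_1[OF U, where \<iota> = \<iota>]
        inner_vec_def U mult_ac)
qed

section \<open>Iteration\<close>

text \<open>A list rather than a set: a term may arise repeatedly, and its multiplicity is its coefficient.\<close>

primrec remainder_terms ::
    "nat \<Rightarrow> ((letter \<times> nat) list \<times> (letter \<times> nat) list \<times> (letter \<times> nat) list) list" where
  "remainder_terms 0 = [([], [], [])]"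
| "remainder_terms (Suc k) = concat (map successors (remainder_terms k))"

definition remainder :: "nat \<Rightarrow> 'n::finite trilinear" where
  "remainder k u v w x = (\<Sum>t\<leftarrow>remainder_terms k. tensor_term t u v w x)"

lemma remainder_terms_tensor_terms: "set (remainder_terms k) \<subseteq> tensor_terms k"
proof (induction k)
  case 0
  show ?case by (simp add: tensor_terms_def orders_ok_def indices_def)
next
  case (Suc k)
  then show ?case by (auto intro: successors_tensor_terms)
qed

lemma tensor_terms_mono: "k \<le> l \<Longrightarrow> tensor_terms k \<subseteq> tensor_terms l"
  by (auto simp: tensor_terms_def orders_ok_def)

lemma sum_list_eq_sum_count:
  fixes f :: "'a \<Rightarrow> real"
  shows "(\<Sum>t\<leftarrow>ts. f t) = (\<Sum>t\<in>set ts. real (count_list ts t) * f t)"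
proof (induction ts)
  case (Cons a ts)
  have "(\<Sum>t\<in>set (a # ts). real (count_list (a # ts) t) * f t)
      = (\<Sum>t\<in>set (a # ts). (if t = a then f t else 0) + real (count_list ts t) * f t)"
    by (intro sum.cong) (auto simp: algebra_simps)
  also have "\<dots> = f a + (\<Sum>t\<in>set (a # ts). real (count_list ts t) * f t)"
    by (simp add: sum.distrib)
  also have "(\<Sum>t\<in>set (a # ts). real (count_list ts t) * f t) = (\<Sum>t\<in>set ts. real (count_list ts t) * f t)"
    by (rule sum.mono_neutral_right) (auto simp: count_list_0_iff)
  finally show ?case using Cons by simp
qed simp

lemma linear_combination_sum_list:
  assumes "set ts \<subseteq> T" "\<And>u v w x. R u v w x = (\<Sum>t\<leftarrow>ts. term t u v w x)"
  shows "linear_combination term T R"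
  unfolding linear_combination_def using assms
  by (intro exI[of _ "set ts"] exI[of _ "\<lambda>t. real (count_list ts t)"]) (simp add: sum_list_eq_sum_count)

lemma linear_combination_tensor_remainder:
  "linear_combination tensor_term (tensor_terms k) (remainder k)"
  using remainder_terms_tensor_terms by (rule linear_combination_sum_list) (rule remainder_def)

lemma linear_combination_P_remainder:
  assumes "k \<le> 1 \<or> CARD('n::finite) = 1"
  shows "linear_combination P_term (P_terms k) (remainder k :: 'n trilinear)"
proof (rule linear_combination_sum_list)
  show "set (map forget_indices (remainder_terms k)) \<subseteq> P_terms k"
    using remainder_terms_tensor_terms[of k] forget_indices_P_terms by auto
  fix u v w :: "real^'n \<Rightarrow> real" and x
  have "(tensor_term t :: 'n trilinear) = P_term (forget_indices t)" if "t \<in> set (remainder_terms k)" for t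
  proof -
    have t: "t \<in> tensor_terms k" using that remainder_terms_tensor_terms by auto
    from assms show ?thesis
    proof
      assume "k \<le> 1"
      with t have "t \<in> tensor_terms 1" using tensor_terms_mono by blast
      then show ?thesis by (rule tensor_term_eq_P_term_order_1)
    qed (rule tensor_term_eq_P_term_dim_1[OF t])
  qed
  then show "remainder k u v w x = (\<Sum>t\<leftarrow>map forget_indices (remainder_terms k). P_term t u v w x)"
    by (simp add: remainder_def o_def cong: map_cong)
qed

lemma integral_sum_list:
  fixes f :: "'b \<Rightarrow> 'a \<Rightarrow> real"
  assumes "\<And>t. t \<in> set ts \<Longrightarrow> integrable M (f t)"
  shows "integrable M (\<lambda>x. \<Sum>t\<leftarrow>ts. f t x) \<and> (\<integral>x. (\<Sum>t\<leftarrow>ts. f t x) \<partial>M) = (\<Sum>t\<leftarrow>ts. \<integral>x. f t x \<partial>M)"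
  using assms by (induction ts) auto

text \<open>Move \<open>H\<close> from \<open>e\<^sub>1\<close> to the other factor, in two evaluations of \<open>\<integral> (H e\<^sub>1) T\<close>.\<close>

lemma L_tensor_term_step:
  fixes e1 e2 e3 e4 :: "real^'n::finite \<Rightarrow> real"
  assumes e: "eigenfunction e1 l1" "eigenfunction e2 l2" "eigenfunction e3 l3" "eigenfunction e4 l4"
  shows "(l1 - l2 - l3 - l4) * L (tensor_term t) e1 e2 e3 e4
    = - 2 * (\<Sum>t'\<leftarrow>successors t. L (tensor_term t') e1 e2 e3 e4)"
proof -
  note g = e[THEN eigenfunction_gauss]
  have H: "harmonic_oscillator e1 = (\<lambda>x. l1 * e1 x)" "harmonic_oscillator e2 = (\<lambda>x. l2 * e2 x)"
    "harmonic_oscillator e3 = (\<lambda>x. l3 * e3 x)" "harmonic_oscillator e4 = (\<lambda>x. l4 * e4 x)"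
    using e by (auto simp: eigenfunction_def)
  let ?T = "\<lambda>t x. tensor_term t e2 e3 e4 x"
  have gT: "gauss (1 + 1 + 1) (?T t)" for t
    by (intro gauss_tensor_term g)
  have int: "integrable lborel (\<lambda>x. e1 x * ?T t x)" for t
    by (rule gauss_integrable[OF gauss_mult[OF g(1) gT]]) simp
  have ints: "integrable lborel (\<lambda>x. \<Sum>t'\<leftarrow>successors t. e1 x * ?T t' x)"
    and sums: "(\<integral>x. (\<Sum>t'\<leftarrow>successors t. e1 x * ?T t' x) \<partial>lborel)
      = (\<Sum>t'\<leftarrow>successors t. \<integral>x. e1 x * ?T t' x \<partial>lborel)"
    using integral_sum_list[of "successors t" lborel "\<lambda>t x. e1 x * ?T t x"] int by blast+
  have "l1 * L (tensor_term t) e1 e2 e3 e4 = (\<integral>x. harmonic_oscillator e1 x * ?T t x \<partial>lborel)"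
    by (simp add: L_def H(1) mult.assoc)
  also have "\<dots> = (\<integral>x. e1 x * harmonic_oscillator (?T t) x \<partial>lborel)"
    by (rule harmonic_oscillator_symmetric[OF g(1) gT]) simp
  also have "\<dots> = (\<integral>x. (l2 + l3 + l4) * (e1 x * ?T t x)
      - 2 * (\<Sum>t'\<leftarrow>successors t. e1 x * ?T t' x) \<partial>lborel)"
    by (intro Bochner_Integration.integral_cong refl)
      (simp add: harmonic_oscillator_tensor_term[OF g(2-4)[THEN smooth_with_smooth] H(2-4)]
        sum_list_const_mult algebra_simps)
  also have "\<dots> = (l2 + l3 + l4) * L (tensor_term t) e1 e2 e3 e4
      - 2 * (\<Sum>t'\<leftarrow>successors t. L (tensor_term t') e1 e2 e3 e4)"
    using int ints by (simp add: sums L_def)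
  finally show ?thesis by (simp add: algebra_simps)
qed

lemma sum_list_concat_map: "(\<Sum>b\<leftarrow>concat (map f as). g b) = (\<Sum>a\<leftarrow>as. \<Sum>b\<leftarrow>f a. g b :: real)"
  by (induction as) simp_all

lemma L_remainder_step:
  fixes e1 e2 e3 e4 :: "real^'n::finite \<Rightarrow> real"
  assumes e: "eigenfunction e1 l1" "eigenfunction e2 l2" "eigenfunction e3 l3" "eigenfunction e4 l4"
  shows "(l1 - l2 - l3 - l4) * L (remainder k) e1 e2 e3 e4 = - 2 * L (remainder (Suc k)) e1 e2 e3 e4"
proof -
  note g = e[THEN eigenfunction_gauss]
  have int: "integrable lborel (\<lambda>x. e1 x * tensor_term t e2 e3 e4 x)" for t
    by (rule gauss_integrable[OF gauss_mult[OF g(1) gauss_tensor_term[OF g(2-4)]]]) simp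
  have sum: "L (remainder k) e1 e2 e3 e4 = (\<Sum>t\<leftarrow>remainder_terms k. L (tensor_term t) e1 e2 e3 e4)" for k
    using integral_sum_list[of "remainder_terms k" lborel "\<lambda>t x. e1 x * tensor_term t e2 e3 e4 x"] int
    by (simp add: L_def remainder_def sum_list_const_mult)
  have "(l1 - l2 - l3 - l4) * L (remainder k) e1 e2 e3 e4
      = (\<Sum>t\<leftarrow>remainder_terms k. - 2 * (\<Sum>t'\<leftarrow>successors t. L (tensor_term t') e1 e2 e3 e4))"
    unfolding sum sum_list_const_mult[symmetric] L_tensor_term_step[OF e] ..
  also have "\<dots> = - 2 * (\<Sum>t\<leftarrow>remainder_terms k. \<Sum>t'\<leftarrow>successors t. L (tensor_term t') e1 e2 e3 e4)"
    by (rule sum_list_const_mult)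
  also have "(\<Sum>t\<leftarrow>remainder_terms k. \<Sum>t'\<leftarrow>successors t. L (tensor_term t') e1 e2 e3 e4)
      = L (remainder (Suc k)) e1 e2 e3 e4"
    by (simp add: sum sum_list_concat_map)
  finally show ?thesis .
qed

theorem theorem4p1:
  fixes k :: nat
  shows "\<exists>R :: 'n::finite trilinear.
    linear_combination tensor_term (tensor_terms k) R \<and>
    (k \<le> 1 \<or> CARD('n) = 1 \<longrightarrow> linear_combination P_term (P_terms k) R) \<and>
    (\<forall>(e1 :: real^'n \<Rightarrow> real) e2 e3 e4 (\<mu>1 :: real) \<mu>2 \<mu>3 \<mu>4.
      eigenfunction e1 (\<mu>1\<^sup>2) \<and> eigenfunction e2 (\<mu>2\<^sup>2) \<and>
      eigenfunction e3 (\<mu>3\<^sup>2) \<and> eigenfunction e4 (\<mu>4\<^sup>2) \<and>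
      \<mu>1\<^sup>2 - \<mu>2\<^sup>2 - \<mu>3\<^sup>2 - \<mu>4\<^sup>2 \<noteq> 0 \<longrightarrow>
      L0 e1 e2 e3 e4 = (-2) ^ k / (\<mu>1\<^sup>2 - \<mu>2\<^sup>2 - \<mu>3\<^sup>2 - \<mu>4\<^sup>2) ^ k * L R e1 e2 e3 e4)"
proof (intro exI[of _ "remainder k"] conjI impI allI)
  show "linear_combination tensor_term (tensor_terms k) (remainder k :: 'n trilinear)"
    by (rule linear_combination_tensor_remainder)
  show "linear_combination P_term (P_terms k) (remainder k :: 'n trilinear)"
    if "k \<le> 1 \<or> CARD('n) = 1"
    using that by (rule linear_combination_P_remainder)
  fix e1 e2 e3 e4 :: "real^'n \<Rightarrow> real" and \<mu>1 \<mu>2 \<mu>3 \<mu>4 :: real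
  let ?D = "\<mu>1\<^sup>2 - \<mu>2\<^sup>2 - \<mu>3\<^sup>2 - \<mu>4\<^sup>2"
  assume "eigenfunction e1 (\<mu>1\<^sup>2) \<and> eigenfunction e2 (\<mu>2\<^sup>2) \<and>
      eigenfunction e3 (\<mu>3\<^sup>2) \<and> eigenfunction e4 (\<mu>4\<^sup>2) \<and> ?D \<noteq> 0"
  then have e: "eigenfunction e1 (\<mu>1\<^sup>2)" "eigenfunction e2 (\<mu>2\<^sup>2)"
      "eigenfunction e3 (\<mu>3\<^sup>2)" "eigenfunction e4 (\<mu>4\<^sup>2)" and D: "?D \<noteq> 0" by auto
  show "L0 e1 e2 e3 e4 = (-2) ^ k / ?D ^ k * L (remainder k) e1 e2 e3 e4"
  proof (induction k)
    case 0
    show ?case by (simp add: L0_def L_def remainder_def tensor_term_def indices_def mult.assoc)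
  next
    case (Suc k)
    have "L (remainder k) e1 e2 e3 e4 = (- 2) / ?D * L (remainder (Suc k)) e1 e2 e3 e4"
      using L_remainder_step[OF e, of k] D by (simp add: field_simps)
    then show ?case unfolding Suc by (simp add: mult_ac)
  qed
qed

end
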